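(* Let $z_{\varphi_c^4}(\hbar_{\mathrm{ren}})$ be the vertex renormalization constant of zero-dimensional $\varphi^4$-theory. There are real numbers $c_0,c_1,\dots$ such that for every $R\ge0$, as $n\to\infty$, $$[\hbar_{\mathrm{ren}}^n]\big(1-z_{\varphi_c^4}(\hbar_{\mathrm{ren}})\big)=\frac{e^{-\frac{15}{4}}}{\sqrt2\,\pi}\sum_{k=0}^{R-1}c_k\left(\tfrac23\right)^{n+3-k}\Gamma(n+3-k)+\mathcal{O}\left(\left(\tfrac23\right)^{n}\Gamma(n+3-R)\right),$$ with $c_0=36$, $c_1=-\frac{243}{2}$, $c_2=\frac{729}{32}$, $c_3=-\frac{51057}{256}$; equivalently, $$[\hbar_{\mathrm{ren}}^n]\big(1-z_{\varphi_c^4}\big)\sim\frac{e^{-\frac{15}{4}}}{\sqrt2\,\pi}\left(\tfrac23\right)^{n+3}\Gamma(n+3)\left(36-\tfrac32\tfrac{243}{2}\tfrac{1}{n+2}+\left(\tfrac32\right)^2\tfrac{729}{32}\tfrac{1}{(n+1)(n+2)}-\left(\tfrac32\right)^3\tfrac{51057}{256}\tfrac{1}{n(n+1)(n+2)}+\cdots\right).$$ The coefficients of $1-z_{\varphi_c^4}(\hbar_{\mathrm{ren}})+3\sum_{n\ge2}(-1)^n\left(\frac{\hbar_{\mathrm{ren}}}{2}\right)^n$ have the same asymptotic expansion.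
   Context: The partition function is the formal perturbative expansion of $\int\frac{dx}{\sqrt{2\pi\hbar}}e^{\frac1\hbar(-\frac{x^2}{2}+\frac{x^4}{4!}+xj)}$; its $j$-derivatives at $j=0$ are $Z_{2m}(\hbar):=\partial_j^{2m}Z|_{j=0}=\sum_{k\ge0}\hbar^{k-m}\frac{(4k+2m-1)!!}{(4!)^kk!}$, odd ones vanish. The free energy $W=\hbar\log Z$ has $W_2:=\partial_j^2W|_{j=0}=\hbar\frac{Z_2}{Z_0}$ and $W_4:=\partial_j^4W|_{j=0}=\hbar\left(\frac{Z_4}{Z_0}-3\frac{Z_2^2}{Z_0^2}\right)$, both power series in $\hbar$. The effective action $G$ (Legendre transform of $W$ in $j$) has $G_2:=\partial_{\varphi_c}^2G|_{\varphi_c=0}=-\frac1{W_2}$ and $G_4:=\partial_{\varphi_c}^4G|_{\varphi_c=0}=\frac{W_4}{W_2^4}$. Renormalization: the squared invariant charge is $\alpha(\hbar)=\left(\frac{G_4(\hbar)^{1/2}}{G_2(\hbar)}\right)^2$; $\hbar(\hbar_{\mathrm{ren}})=\hbar_{\mathrm{ren}}+\cdots$ is the unique power series with $\hbar_{\mathrm{ren}}=\hbar(\hbar_{\mathrm{ren}})\,\alpha(\hbar(\hbar_{\mathrm{ren}}))$; and $z_{\varphi_c^4}(\hbar_{\mathrm{ren}})=1/G_4(\hbar(\hbar_{\mathrm{ren}}))=1-\tfrac32\hbar_{\mathrm{ren}}+\tfrac34\hbar_{\mathrm{ren}}^2-\cdots$. *)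

theory Defs
  imports
    "HOL-Analysis.Analysis"
    "HOL-Computational_Algebra.Formal_Laurent_Series"
    "HOL-Library.Landau_Symbols"
begin

unbundle no vec_syntax
unbundle fps_syntax

text \<open>
  Formal objects in \<open>\<hbar>\<close> are Laurent series (\<open>real fls\<close>) or power series (\<open>real fps\<close>).
  Formal objects in the source \<open>j\<close> (or in \<open>\<phi>\<^sub>c\<close>) with coefficients depending on \<open>\<hbar>\<close> are
  power series over Laurent series (\<open>real fls fps\<close>).
\<close>

text \<open>\<open>odd_dfact N\<close> is \<open>(2 N - 1)!!\<close>, with \<open>(-1)!! = 1\<close>.\<close>

definition odd_dfact :: "nat \<Rightarrow> real" where
  "odd_dfact N = (\<Prod>i<N. real (2 * i + 1))"

text \<open>The factor \<open>\<hbar>\<^sup>-\<^sup>m\<close> is realised by \<open>fls_shift\<close>, since \<open>2 k + m\<close> in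
  \<open>odd_dfact\<close> corresponds to \<open>(4 k + 2 m - 1)!!\<close>.\<close>

definition phi4_Z_even :: "nat \<Rightarrow> real fls" where
  "phi4_Z_even m =
     fls_shift (int m) (fps_to_fls (Abs_fps (\<lambda>k. odd_dfact (2 * k + m) / (fact 4 ^ k * fact k))))"

definition phi4_Z :: "real fls fps" where
  "phi4_Z = Abs_fps (\<lambda>l. if even l then phi4_Z_even (l div 2) / fact l else 0)"

text \<open>The logarithm is \<open>log Z = log Z\<^sub>0 + log (Z / Z\<^sub>0)\<close>, where \<open>Z\<^sub>0\<close> is the coefficient of \<open>j\<^sup>0\<close>,
  a power series in \<open>\<hbar>\<close> with constant term 1; \<open>fps_ln 1\<close> is the series of \<open>log (1 + x)\<close>.\<close>

definition phi4_W :: "real fls fps" where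
  "phi4_W = fps_const fls_X *
     (fps_const (fps_to_fls (fps_ln 1 oo (fls_regpart (phi4_Z $ 0) - 1)))
      + (fps_ln 1 oo (fps_const (inverse (phi4_Z $ 0)) * phi4_Z - 1)))"

text \<open>Legendre transform: \<open>G(\<phi>\<^sub>c) = W(j) - j \<phi>\<^sub>c\<close> at \<open>j = j(\<phi>\<^sub>c)\<close>, the solution of
  \<open>\<phi>\<^sub>c = \<partial>\<^sub>j W(j)\<close>.\<close>

definition phi4_j :: "real fls fps" where
  "phi4_j = fps_inv (fps_deriv phi4_W)"

definition phi4_G :: "real fls fps" where
  "phi4_G = (phi4_W oo phi4_j) - phi4_j * fps_X"

text \<open>No negative powers of \<open>\<hbar>\<close> occur in the following two series, so \<open>fls_regpart\<close> only
  changes the type; see \<open>phi4_G2_fls\<close> and \<open>phi4_G4_fls\<close>.\<close>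

definition phi4_G2 :: "real fps" where
  "phi4_G2 = fls_regpart (fps_nth_deriv 2 phi4_G $ 0)"

definition phi4_G4 :: "real fps" where
  "phi4_G4 = fls_regpart (fps_nth_deriv 4 phi4_G $ 0)"

definition phi4_alpha :: "real fps" where
  "phi4_alpha = (fps_radical root 2 phi4_G4 / phi4_G2)\<^sup>2"

text \<open>The condition on the constant term makes the composition meaningful; for existence and
  uniqueness see \<open>phi4_hbar_ex1\<close>.\<close>

definition phi4_hbar :: "real fps" where
  "phi4_hbar = (THE h. h $ 0 = 0 \<and> h $ 1 = 1 \<and> h * (phi4_alpha oo h) = fps_X)"

definition phi4_z :: "real fps" where
  "phi4_z = 1 / (phi4_G4 oo phi4_hbar)"


subsection \<open>Consistency of the definitions\<close>

lemma fps_nth_deriv_at_0: "fps_nth_deriv n (f :: 'a :: field_char_0 fps) $ 0 = fact n * f $ n"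
  by (simp add: fps_deriv_maclauren_0)

lemma phi4_Z_even_deriv: "fps_nth_deriv (2 * m) phi4_Z $ 0 = phi4_Z_even m"
  by (simp add: fps_nth_deriv_at_0 phi4_Z_def)

lemma phi4_Z_odd_deriv: "odd l \<Longrightarrow> fps_nth_deriv l phi4_Z $ 0 = 0"
  by (simp add: fps_nth_deriv_at_0 phi4_Z_def)

definition phi4_P :: "nat \<Rightarrow> real fps" where
  "phi4_P m = Abs_fps (\<lambda>k. odd_dfact (2 * k + m) / (fact 4 ^ k * fact k))"

lemma phi4_Z_even_P: "phi4_Z_even m = fls_X_inv ^ m * fps_to_fls (phi4_P m)"
  by (simp add: phi4_Z_even_def phi4_P_def fls_X_inv_power_times_conv_shift)

lemma phi4_Z_0: "phi4_Z $ 0 = fps_to_fls (phi4_P 0)"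
  by (simp add: phi4_Z_def phi4_Z_even_P)

lemma phi4_P_coeffs:
  "phi4_P 0 $ 0 = 1" "phi4_P 0 $ 1 = 1/8"
  "phi4_P 1 $ 0 = 1" "phi4_P 1 $ 1 = 5/8"
  "phi4_P (Suc 0) $ 0 = 1" "phi4_P (Suc 0) $ 1 = 5/8"
  "phi4_P 2 $ 0 = 3" "phi4_P 2 $ 1 = 35/8"
  by (simp_all add: phi4_P_def odd_dfact_def fact_numeral eval_nat_numeral)

lemma phi4_Z_0_nz: "phi4_Z $ 0 \<noteq> 0"
proof -
  have "phi4_P 0 \<noteq> 0" using phi4_P_coeffs(1) by force
  thus ?thesis by (simp add: phi4_Z_0)
qed

lemma fps_to_fls_div:
  fixes f g :: "real fps"
  assumes "g $ 0 \<noteq> 0"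
  shows "fps_to_fls (f / g) = fps_to_fls f / fps_to_fls g"
  using assms by (intro fls_divide_fps_to_fls [symmetric]) (simp add: subdegree_eq_0)

lemma phi4_Z_deriv: "phi4_Z * fps_deriv phi4_W = fps_const fls_X * fps_deriv phi4_Z"
proof -
  let ?c = "inverse (phi4_Z $ 0)"
  let ?u = "fps_const ?c * phi4_Z - 1"
  have u0: "?u $ 0 = 0" using phi4_Z_0_nz by simp
  have nz: "?c \<noteq> 0" using phi4_Z_0_nz by simp
  have Znz: "phi4_Z \<noteq> 0" using phi4_Z_0_nz by force
  have "inverse (1 + fps_X) oo ?u = inverse ((1 + fps_X) oo ?u)"
    by (rule fps_inverse_compose[OF u0]) simp
  also have "(1 + fps_X) oo ?u = fps_const ?c * phi4_Z"
    by (simp only: fps_compose_add_distrib fps_compose_1 fps_X_fps_compose_startby0[OF u0]) simp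
  finally have "fps_deriv phi4_W =
      fps_const fls_X * (inverse (fps_const ?c * phi4_Z) * (fps_const ?c * fps_deriv phi4_Z))"
    unfolding phi4_W_def by (simp add: fps_compose_deriv[OF u0] fps_ln_deriv)
  moreover have "(fps_const ?c * phi4_Z) * inverse (fps_const ?c * phi4_Z) = 1"
    by (rule inverse_mult_eq_1') (use phi4_Z_0_nz in simp)
  ultimately have "fps_const ?c * (phi4_Z * fps_deriv phi4_W)
      = fps_const ?c * (fps_const fls_X * fps_deriv phi4_Z)"
    by (metis (no_types, lifting) mult.assoc mult.commute mult.left_neutral)
  moreover have "fps_const ?c \<noteq> 0" using nz by simp
  ultimately show ?thesis by (metis mult_left_cancel)
qed

lemma phi4_W_1: "phi4_W $ 1 = 0"
  using arg_cong[OF phi4_Z_deriv, of "\<lambda>f. f $ 0"] phi4_Z_0_nz by (simp add: phi4_Z_def)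

lemma phi4_W_2: "fps_nth_deriv 2 phi4_W $ 0 = fls_X * (phi4_Z_even 1 / phi4_Z_even 0)"
proof -
  have "phi4_Z $ 0 * (2 * phi4_W $ 2) = fls_X * (2 * phi4_Z $ 2)"
    using arg_cong[OF phi4_Z_deriv, of "\<lambda>f. f $ 1"] phi4_W_1
    by (simp add: fps_mult_nth_1 eval_nat_numeral)
  moreover have "2 * phi4_Z $ 2 = phi4_Z_even 1" "phi4_Z $ 0 = phi4_Z_even 0"
    by (simp_all add: phi4_Z_def)
  ultimately show ?thesis using phi4_Z_0_nz
    by (simp add: fps_nth_deriv_at_0 field_simps)
qed

lemma phi4_Z_odd: "phi4_Z $ Suc 0 = 0" "phi4_Z $ Suc (Suc (Suc 0)) = 0"
  by (simp_all add: phi4_Z_def)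

lemma phi4_W_3: "phi4_W $ 3 = 0"
proof -
  have "phi4_Z $ 0 * (3 * phi4_W $ 3) = 0"
    using arg_cong[OF phi4_Z_deriv, of "\<lambda>f. f $ 2"] phi4_W_1
    by (simp add: fps_mult_nth[of phi4_Z] fps_mult_left_const_nth eval_nat_numeral phi4_Z_odd)
  thus ?thesis using phi4_Z_0_nz by simp
qed

lemma phi4_W_4: "fps_nth_deriv 4 phi4_W $ 0 =
   fls_X * (phi4_Z_even 2 / phi4_Z_even 0 - 3 * (phi4_Z_even 1)\<^sup>2 / (phi4_Z_even 0)\<^sup>2)"
proof -
  have "fls_X * (4 * phi4_Z $ 4) = phi4_Z $ 0 * (4 * phi4_W $ 4) + phi4_Z $ 2 * (2 * phi4_W $ 2)"
    using arg_cong[OF phi4_Z_deriv, of "\<lambda>f. f $ 3"] phi4_W_1 phi4_W_3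
    by (simp add: fps_mult_nth[of phi4_Z] fps_mult_left_const_nth eval_nat_numeral phi4_Z_odd)
  hence "fls_X * (24 * phi4_Z $ 4)
      = phi4_Z $ 0 * (24 * phi4_W $ 4) + 3 * ((2 * phi4_Z $ 2) * (2 * phi4_W $ 2))"
  proof -
    have "fls_X * (24 * phi4_Z $ 4) = 6 * (fls_X * (4 * phi4_Z $ 4))" by simp
    also assume "fls_X * (4 * phi4_Z $ 4)
        = phi4_Z $ 0 * (4 * phi4_W $ 4) + phi4_Z $ 2 * (2 * phi4_W $ 2)"
    finally show ?thesis by (simp add: distrib_left)
  qed
  moreover have "2 * phi4_Z $ 2 = phi4_Z_even 1" "phi4_Z $ 0 = phi4_Z_even 0"
      "24 * phi4_Z $ 4 = phi4_Z_even 2"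
    by (simp_all add: phi4_Z_def fact_numeral)
  moreover have "2 * phi4_W $ 2 = fls_X * (phi4_Z_even 1 / phi4_Z_even 0)"
    using phi4_W_2 by (simp add: fps_nth_deriv_at_0)
  ultimately have "fls_X * phi4_Z_even 2 = phi4_Z_even 0 * (24 * phi4_W $ 4)
      + 3 * (phi4_Z_even 1 * (fls_X * (phi4_Z_even 1 / phi4_Z_even 0)))"
    by metis
  moreover have "phi4_Z_even 0 \<noteq> 0" using phi4_Z_0_nz by (simp add: phi4_Z_def)
  ultimately show ?thesis
    by (simp add: fps_nth_deriv_at_0 fact_numeral field_simps power2_eq_square)
qed

lemma fls_X_cancel: "fls_X * fls_X_inv = (1 :: real fls)"
  by (simp add: fls_X_times_conv_shift)

lemma phi4_W_2_fls: "fps_nth_deriv 2 phi4_W $ 0 = fps_to_fls (phi4_P 1 / phi4_P 0)"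
proof -
  have "phi4_P 0 $ 0 \<noteq> 0" by (simp add: phi4_P_coeffs)
  thus ?thesis unfolding phi4_W_2
    using fls_X_cancel by (simp add: phi4_Z_even_P fps_to_fls_div flip: mult.assoc)
qed

lemma phi4_W_4_fls: "fps_nth_deriv 4 phi4_W $ 0 =
   fps_to_fls (fps_shift 1 (phi4_P 2 / phi4_P 0 - 3 * (phi4_P 1 / phi4_P 0)\<^sup>2))"
proof -
  let ?A = "phi4_P 2 / phi4_P 0 - 3 * (phi4_P 1 / phi4_P 0)\<^sup>2"
  have P0: "phi4_P 0 $ 0 \<noteq> 0" by (simp add: phi4_P_coeffs)
  have "?A $ 0 = 0"
    by (simp add: fps_divide_unit[OF P0] phi4_P_coeffs power2_eq_square numeral_fps_const)
  hence A: "?A = fps_X * fps_shift 1 ?A"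
    by (intro fps_ext) (auto simp: fps_X_mult_nth)
  note X = fls_X_cancel
  have rearrange: "Y ^ 2 * b / (Y ^ 0 * a) - 3 * (Y ^ 1 * c)\<^sup>2 / (Y ^ 0 * a)\<^sup>2
      = Y ^ 2 * (b / a - 3 * (c / a)\<^sup>2)" for Y a b c :: "real fls"
    by (simp add: power_mult_distrib power_divide right_diff_distrib)
  have A': "fps_to_fls ?A = fps_to_fls (phi4_P 2) / fps_to_fls (phi4_P 0)
      - 3 * (fps_to_fls (phi4_P 1) / fps_to_fls (phi4_P 0))\<^sup>2"
    by (simp only: fps_to_fls_minus fls_times_fps_to_fls fps_to_fls_power
          fps_to_fls_div[OF P0] fps_to_fls_numeral)
  have "fps_nth_deriv 4 phi4_W $ 0 = fls_X * (fls_X_inv ^ 2 * fps_to_fls ?A)"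
    unfolding phi4_W_4 phi4_Z_even_P rearrange A' ..
  also have "\<dots> = fls_X_inv * fps_to_fls ?A"
    using X by (simp add: power2_eq_square flip: mult.assoc)
  also have "\<dots> = fls_X_inv * (fls_X * fps_to_fls (fps_shift 1 ?A))"
    by (subst A) (simp add: fls_times_fps_to_fls del: fps_shift_diff)
  also have "\<dots> = fps_to_fls (fps_shift 1 ?A)"
    using X by (simp add: mult.commute[of fls_X_inv] flip: mult.assoc)
  finally show ?thesis .
qed

lemma phi4_W2_nz: "fps_nth_deriv 2 phi4_W $ 0 \<noteq> 0"
proof -
  have "phi4_P 0 $ 0 \<noteq> 0" by (simp add: phi4_P_coeffs)
  hence "(phi4_P 1 / phi4_P 0) $ 0 = 1" by (simp add: fps_divide_unit phi4_P_coeffs)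
  thus ?thesis unfolding phi4_W_2_fls by (metis fps_to_fls_eq_0_iff fps_zero_nth zero_neq_one)
qed

lemma phi4_W_inv:
  "fps_deriv phi4_W $ 0 = 0" "fps_deriv phi4_W $ 1 \<noteq> 0" "phi4_j $ 0 = 0"
  "fps_deriv phi4_W oo phi4_j = fps_X"
proof -
  show 1: "fps_deriv phi4_W $ 0 = 0" using phi4_W_1 by simp
  show 2: "fps_deriv phi4_W $ 1 \<noteq> 0" using phi4_W2_nz
    by (simp add: fps_nth_deriv_at_0 eval_nat_numeral)
  show "phi4_j $ 0 = 0" by (simp add: phi4_j_def fps_inv_def)
  show "fps_deriv phi4_W oo phi4_j = fps_X"
    unfolding phi4_j_def by (rule fps_inv_right[OF 1 2])
qed

lemma phi4_G_deriv: "fps_deriv phi4_G = - phi4_j"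
  by (simp add: phi4_G_def fps_compose_deriv[OF phi4_W_inv(3)] phi4_W_inv(4) algebra_simps)

lemma phi4_j_coeffs:
  "phi4_j $ 1 * (2 * phi4_W $ 2) = 1"
  "3 * phi4_j $ 3 * (2 * phi4_W $ 2) + 12 * phi4_W $ 4 * (phi4_j $ 1) ^ 3 = 0"
proof -
  let ?a = "fps_deriv (fps_deriv phi4_W)"
  have a: "(?a oo phi4_j) $ 0 = 2 * phi4_W $ 2" by (simp add: eval_nat_numeral)
  have "fps_deriv phi4_j = inverse (?a oo phi4_j)"
    unfolding phi4_j_def by (rule fps_inv_deriv[OF phi4_W_inv(1,2)])
  moreover have "(?a oo phi4_j) $ 0 \<noteq> 0"
    using phi4_W_inv(2) by (simp add: eval_nat_numeral)
  ultimately have *: "fps_deriv phi4_j * (?a oo phi4_j) = 1"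
    by (simp add: inverse_mult_eq_1)
  show "phi4_j $ 1 * (2 * phi4_W $ 2) = 1"
    using arg_cong[OF *, of "\<lambda>f. f $ 0"] by (simp add: eval_nat_numeral)
  have a1: "(?a oo phi4_j) $ 1 = 0"
    using phi4_W_3 by (simp add: fps_compose_nth eval_nat_numeral)
  have a2: "(?a oo phi4_j) $ 2 = 12 * phi4_W $ 4 * (phi4_j $ 1)\<^sup>2"
  proof -
    have "(?a oo phi4_j) $ 2
        = ?a $ 0 * (phi4_j ^ 0) $ 2 + ?a $ 1 * (phi4_j ^ 1) $ 2 + ?a $ 2 * (phi4_j\<^sup>2) $ 2"
      by (simp add: fps_compose_nth atLeast0_atMost_Suc numeral_2_eq_2 del: fps_deriv_nth power_Suc)
    moreover have "?a $ 1 = 0" using phi4_W_3 by (simp add: eval_nat_numeral)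
    moreover have "?a $ 2 = 12 * phi4_W $ 4" by (simp add: eval_nat_numeral)
    moreover have "(phi4_j\<^sup>2) $ 2 = (phi4_j $ 1)\<^sup>2"
      by (rule startsby_zero_power_nth_same[OF phi4_W_inv(3)])
    ultimately show ?thesis by simp
  qed
  have "fps_deriv phi4_j $ 0 * (?a oo phi4_j) $ 2 + fps_deriv phi4_j $ 1 * (?a oo phi4_j) $ 1
      + fps_deriv phi4_j $ 2 * (?a oo phi4_j) $ 0 = 0"
    using arg_cong[OF *, of "\<lambda>f. f $ 2"]
    by (simp add: fps_mult_nth[of "fps_deriv phi4_j"] eval_nat_numeral del: fps_deriv_nth fps_compose_nth_0)
  thus "3 * phi4_j $ 3 * (2 * phi4_W $ 2) + 12 * phi4_W $ 4 * (phi4_j $ 1) ^ 3 = 0"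
    unfolding a a1 a2 by (simp add: eval_nat_numeral algebra_simps)
qed

lemma phi4_G_2: "fps_nth_deriv 2 phi4_G $ 0 = - 1 / (fps_nth_deriv 2 phi4_W $ 0)"
proof -
  have "2 * phi4_G $ 2 = - phi4_j $ 1"
    using arg_cong[OF phi4_G_deriv, of "\<lambda>f. f $ 1"] by (simp add: eval_nat_numeral)
  thus ?thesis using phi4_j_coeffs(1) phi4_W2_nz
    by (simp add: fps_nth_deriv_at_0 field_simps)
qed

lemma phi4_G_4:
  "fps_nth_deriv 4 phi4_G $ 0 = fps_nth_deriv 4 phi4_W $ 0 / (fps_nth_deriv 2 phi4_W $ 0) ^ 4"
proof -
  define w where "w = 2 * phi4_W $ 2"
  define v where "v = phi4_W $ 4"
  have w: "w \<noteq> 0" using phi4_W2_nz by (simp add: fps_nth_deriv_at_0 w_def)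
  have j1: "phi4_j $ 1 = 1 / w" using phi4_j_coeffs(1) w by (simp add: w_def field_simps)
  have "3 * phi4_j $ 3 * w + 12 * v * (1 / w) ^ 3 = 0"
    using phi4_j_coeffs(2) unfolding j1 by (simp only: w_def v_def)
  hence *: "3 * phi4_j $ 3 * w = - (12 * v * (1 / w) ^ 3)" by (simp only: eq_neg_iff_add_eq_0)
  have "w ^ 4 = w ^ 3 * w" using power_Suc2[of w 3] by simp
  hence "24 * v / w ^ 4 = - 2 * (- (12 * v * (1 / w) ^ 3)) / w"
    by (simp only: power_one_over) (simp add: divide_inverse)
  also have "\<dots> = - 2 * (3 * phi4_j $ 3 * w) / w" by (simp only: *)
  also have "\<dots> = - 6 * phi4_j $ 3" using w by simp
  finally have "- 6 * phi4_j $ 3 = 24 * v / w ^ 4" ..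
  moreover have "4 * phi4_G $ 4 = - phi4_j $ 3"
    using arg_cong[OF phi4_G_deriv, of "\<lambda>f. f $ 3"] by (simp add: eval_nat_numeral)
  hence "24 * phi4_G $ 4 = - 6 * phi4_j $ 3" by simp
  moreover have "fps_nth_deriv 4 phi4_G $ 0 = 24 * phi4_G $ 4"
    "fps_nth_deriv 4 phi4_W $ 0 = 24 * v" "fps_nth_deriv 2 phi4_W $ 0 = w"
    by (simp_all add: fps_nth_deriv_at_0 fact_numeral w_def v_def)
  ultimately show ?thesis by (simp only:)
qed

lemma phi4_G2_eq: "phi4_G2 = - (phi4_P 0 / phi4_P 1)"
  and phi4_G2_fls: "fps_to_fls phi4_G2 = fps_nth_deriv 2 phi4_G $ 0"
proof -
  have nz: "phi4_P 0 $ 0 \<noteq> 0" "phi4_P 1 $ 0 \<noteq> 0" by (simp_all add: phi4_P_coeffs)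
  have "fps_nth_deriv 2 phi4_G $ 0 = fps_to_fls (- (phi4_P 0 / phi4_P 1))"
    unfolding phi4_G_2 phi4_W_2_fls fps_to_fls_div[OF nz(1)] fps_to_fls_uminus
      fps_to_fls_div[OF nz(2)] by simp
  thus "phi4_G2 = - (phi4_P 0 / phi4_P 1)" "fps_to_fls phi4_G2 = fps_nth_deriv 2 phi4_G $ 0"
    by (simp_all add: phi4_G2_def)
qed

lemma phi4_G4_eq:
  "phi4_G4 = fps_shift 1 (phi4_P 2 / phi4_P 0 - 3 * (phi4_P 1 / phi4_P 0)\<^sup>2) * (phi4_P 0 / phi4_P 1) ^ 4"
  and phi4_G4_fls: "fps_to_fls phi4_G4 = fps_nth_deriv 4 phi4_G $ 0"
proof -
  let ?S = "fps_shift 1 (phi4_P 2 / phi4_P 0 - 3 * (phi4_P 1 / phi4_P 0)\<^sup>2)"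
  have nz: "phi4_P 0 $ 0 \<noteq> 0" "phi4_P 1 $ 0 \<noteq> 0" by (simp_all add: phi4_P_coeffs)
  have "fps_nth_deriv 4 phi4_G $ 0 = fps_to_fls (?S * (phi4_P 0 / phi4_P 1) ^ 4)"
    unfolding phi4_G_4 phi4_W_2_fls phi4_W_4_fls fps_to_fls_div[OF nz(1)] fls_times_fps_to_fls
      fps_to_fls_power fps_to_fls_div[OF nz(2)] by (simp add: field_simps)
  thus "phi4_G4 = ?S * (phi4_P 0 / phi4_P 1) ^ 4"
      "fps_to_fls phi4_G4 = fps_nth_deriv 4 phi4_G $ 0"
    by (simp_all add: phi4_G4_def)
qed

lemma phi4_G2_0: "phi4_G2 $ 0 = - 1"
proof -
  have nz: "phi4_P 1 $ 0 \<noteq> 0" by (simp add: phi4_P_coeffs)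
  show ?thesis using phi4_P_coeffs by (simp add: phi4_G2_eq fps_divide_unit[OF nz])
qed

lemma phi4_G4_0: "phi4_G4 $ 0 = 1"
proof -
  have nz: "phi4_P 0 $ 0 \<noteq> 0" "phi4_P 1 $ 0 \<noteq> 0" by (simp_all add: phi4_P_coeffs)
  have "inverse (phi4_P 0) $ Suc 0 + 1 / 8 = 0"
    using arg_cong[OF inverse_mult_eq_1'[OF nz(1)], of "\<lambda>f. f $ Suc 0"] phi4_P_coeffs by simp
  hence i: "inverse (phi4_P 0) $ Suc 0 = - 1/8" by simp
  define a where "a = phi4_P 2 / phi4_P 0"
  define b where "b = phi4_P 1 / phi4_P 0"
  define c where "c = phi4_P 0 / phi4_P 1"
  have a: "a $ Suc 0 = 4" and b: "b $ 0 = 1" "b $ Suc 0 = 1 / 2" and c: "c $ 0 = 1"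
    using phi4_P_coeffs i
    by (simp_all add: a_def b_def c_def fps_divide_unit[OF nz(1)] fps_divide_unit[OF nz(2)])
  have "(3 * b\<^sup>2) $ Suc 0 = 3 * (b\<^sup>2) $ Suc 0"
    by (simp only: fps_numeral_fps_const fps_mult_left_const_nth)
  also have "\<dots> = 3" using b by (simp add: power2_eq_square)
  finally have "(a - 3 * b\<^sup>2) $ Suc 0 = 1" using a by simp
  thus ?thesis unfolding phi4_G4_eq a_def[symmetric] b_def[symmetric] c_def[symmetric]
    using c by (simp add: fps_power_zeroth)
qed

lemma phi4_alpha_eq: "phi4_alpha = phi4_G4 / phi4_G2\<^sup>2"
proof -
  have nz: "phi4_G2 $ 0 \<noteq> 0" by (simp add: phi4_G2_0)
  have "fps_radical root (Suc 1) phi4_G4 ^ Suc 1 = phi4_G4"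
    by (rule power_radical[THEN iffD1]) (simp_all add: phi4_G4_0)
  hence "(fps_radical root 2 phi4_G4)\<^sup>2 = phi4_G4" by (simp add: numeral_2_eq_2)
  thus ?thesis unfolding phi4_alpha_def using nz
    by (simp add: fps_divide_unit power_mult_distrib fps_inverse_power)
qed

lemma phi4_alpha_0: "phi4_alpha $ 0 = 1"
  unfolding phi4_alpha_eq by (simp add: fps_divide_unit phi4_G2_0 phi4_G4_0 fps_power_zeroth)

lemma phi4_hbar_ex1: "\<exists>!h. h $ 0 = 0 \<and> h $ 1 = 1 \<and> h * (phi4_alpha oo h) = fps_X"
proof -
  define F where "F = fps_X * phi4_alpha"
  have F0: "F $ 0 = 0" and F1: "F $ 1 \<noteq> 0" by (simp_all add: F_def phi4_alpha_0)
  have comp: "F oo h = h * (phi4_alpha oo h)" if "h $ 0 = 0" for h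
    using that by (simp add: F_def fps_compose_mult_distrib fps_X_fps_compose_startby0)
  show ?thesis
  proof (rule ex1I[of _ "fps_inv F"])
    have i0: "fps_inv F $ 0 = 0" by (simp add: fps_inv_def)
    have eq: "fps_inv F * (phi4_alpha oo fps_inv F) = fps_X"
      using comp[OF i0] fps_inv_right[OF F0 F1] by simp
    have "fps_inv F $ 1 = 1"
      using arg_cong[OF eq, of "\<lambda>f. f $ 1"] i0 by (simp add: phi4_alpha_0 fps_mult_nth_1)
    with i0 eq show "fps_inv F $ 0 = 0 \<and> fps_inv F $ 1 = 1 \<and>
        fps_inv F * (phi4_alpha oo fps_inv F) = fps_X" by blast
  next
    fix h assume h: "h $ 0 = 0 \<and> h $ 1 = 1 \<and> h * (phi4_alpha oo h) = fps_X"
    hence Fh: "F oo h = fps_X" using comp by simp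
    have "h = (fps_inv F oo F) oo h"
      using h by (simp add: fps_inv[OF F0 F1] fps_X_fps_compose_startby0)
    also have "\<dots> = fps_inv F oo (F oo h)"
      using h F0 by (simp add: fps_compose_assoc)
    finally show "h = fps_inv F" by (simp add: Fh)
  qed
qed

lemma phi4_hbar:
  "phi4_hbar $ 0 = 0" "phi4_hbar $ 1 = 1" "phi4_hbar * (phi4_alpha oo phi4_hbar) = fps_X"
  using theI'[OF phi4_hbar_ex1] unfolding phi4_hbar_def by blast+

end

(*
  The series s = X z satisfies a quadratic first-order differential equation, obtained from the
  Riccati equation of W_2 by eliminating hbar.  Extracting from the resulting recurrence the terms in
  which one factor of s^2 has small index gives a linear recurrence with a factorially small error;
  it determines the full asymptotic expansion of the coefficients of s up to one overall factor.

  That factor comes from the explicit coefficients of Z_0 and Z_2.  A Moebius substitution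
  hbar = t / (1 + 5/2 t), whose effect on factorially growing coefficients is an explicit sum
  converging to a factor exp (- 15/4), makes hbar_ren = t + O(t^3).  Composition with such a series Y
  changes the coefficients, to leading order, only by s_1 times those of Y, so the leading behaviour
  of s is that of - Y.
*)
theory Submission
  imports Defs
begin

section \<open>The differential equation of the renormalization constant\<close>

text \<open>The obstacle is that \<open>phi4_z\<close> is defined through the compositional inverse
  \<open>phi4_hbar\<close> of a divergent series, none of whose coefficients is explicit. A full
  asymptotic calculus for composition is avoided by dividing the work: the differential equation is
  exact and handles all orders, while the missing factor requires only leading terms, and at leading
  order products reduce to their two extreme terms.

  Contact of second order with the identity is essential in the composition step. For Y = t + y t^2
  + ... the term (n-1) y s_(n-1) has the same size as s_n, and all such terms together build up an
  exponential. Removing y beforehand confines this effect to a substitution whose coefficients are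
  plain binomials.

  Origin of the constants: (4k+1)!! / (24^k k!) grows like (16/24)^k k!, whence 2/3; sqrt 2 / pi
  comes from the reflection formula at 1/4. The argument n+3 of Gamma results from two index shifts
  applied to n!, one from dividing by hbar in the relation for hbar_ren and one from s = X
  z.\<close>

lemma odd_dfact_Suc: "odd_dfact (Suc n) = (2 * real n + 1) * odd_dfact n"
  by (simp add: odd_dfact_def)

lemma fps_X_mult_deriv_nth: "(fps_X * fps_deriv f) $ n = of_nat n * f $ n"
  by (cases n) simp_all

text \<open>Raising the index of the moment by one multiplies the k-th coefficient (4k-1)!! by 4k+1,
  which is the action of the Euler operator 4 X d/dX + 1.\<close>

lemma phi4_P_0_deriv: "4 * fps_X * fps_deriv (phi4_P 0) = phi4_P 1 - phi4_P 0"
proof (rule fps_ext)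
  fix n
  have "(4 * fps_X * fps_deriv (phi4_P 0)) $ n = 4 * real n * phi4_P 0 $ n"
    by (simp only: mult.assoc fps_numeral_fps_const fps_mult_left_const_nth fps_X_mult_deriv_nth)
  also have "\<dots> = (phi4_P 1 - phi4_P 0) $ n"
    by (simp add: phi4_P_def odd_dfact_Suc diff_divide_distrib[symmetric] algebra_simps)
  finally show "(4 * fps_X * fps_deriv (phi4_P 0)) $ n = (phi4_P 1 - phi4_P 0) $ n" .
qed

lemma phi4_P_1_deriv: "4 * fps_X * fps_deriv (phi4_P 1) = phi4_P 2 - 3 * phi4_P 1"
proof (rule fps_ext)
  fix n
  have "(4 * fps_X * fps_deriv (phi4_P 1)) $ n = 4 * real n * phi4_P 1 $ n"
    by (simp only: mult.assoc fps_numeral_fps_const fps_mult_left_const_nth fps_X_mult_deriv_nth)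
  also have "\<dots> = (phi4_P 2 - 3 * phi4_P 1) $ n"
  proof -
    have "odd_dfact (2 * n + 2) = (4 * real n + 3) * odd_dfact (2 * n + 1)"
      using odd_dfact_Suc[of "2 * n + 1"] by simp
    then show ?thesis
      by (simp add: phi4_P_def fps_numeral_fps_const diff_divide_distrib[symmetric] algebra_simps)
  qed
  finally show "(4 * fps_X * fps_deriv (phi4_P 1)) $ n = (phi4_P 2 - 3 * phi4_P 1) $ n" .
qed

text \<open>This is the Dyson-Schwinger equation, i.e. integration by parts of x exp((-x^2/2 +
  x^4/4!)/hbar). It closes the hierarchy of moments at \<open>phi4_P 2\<close>.\<close>

lemma X_phi4_P_2: "fps_X * phi4_P 2 = 6 * (phi4_P 1 - phi4_P 0)"
proof (rule fps_ext)
  fix n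
  show "(fps_X * phi4_P 2) $ n = (6 * (phi4_P 1 - phi4_P 0)) $ n"
  proof (cases n)
    case 0
    then show ?thesis by (simp add: phi4_P_coeffs)
  next
    case (Suc k)
    define o2 where "o2 = odd_dfact (2 * k + 2)"
    have *: "odd_dfact (Suc (2 * Suc k)) - odd_dfact (2 * Suc k) = 4 * real (Suc k) * o2"
      by (subst odd_dfact_Suc) (simp add: o2_def algebra_simps)
    have "(6 * (phi4_P 1 - phi4_P 0)) $ n
        = 6 * (odd_dfact (Suc (2 * Suc k)) - odd_dfact (2 * Suc k)) / (fact 4 ^ Suc k * fact (Suc k))"
      by (simp add: phi4_P_def numeral_fps_const diff_divide_distrib Suc)
    also have "\<dots> = 6 * (4 * real (Suc k) * o2) / (24 * fact 4 ^ k * (real (Suc k) * fact k))"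
      unfolding * by (simp add: fact_numeral)
    also have "\<dots> = o2 / (fact 4 ^ k * fact k)"
      by (simp del: of_nat_Suc)
    finally show ?thesis by (simp add: phi4_P_def Suc o2_def)
  qed
qed

text \<open>The propagator W_2 as a power series.\<close>

definition phi4_w :: "real fps" where
  "phi4_w = phi4_P 1 / phi4_P 0"

lemma phi4_P_nz: "phi4_P 0 \<noteq> 0" "phi4_P 1 \<noteq> 0" "phi4_P (Suc 0) \<noteq> 0"
  using phi4_P_coeffs(1,3) by force+

lemma phi4_w_P: "phi4_P 0 * phi4_w = phi4_P 1"
proof -
  have "phi4_P 0 dvd phi4_P 1"
    by (rule unit_imp_dvd) (simp add: phi4_P_coeffs)
  then show ?thesis by (simp add: phi4_w_def)
qed

lemma phi4_w_0: "phi4_w $ 0 = 1" and phi4_w_1: "phi4_w $ 1 = 1 / 2"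
proof -
  show 0: "phi4_w $ 0 = 1"
    using arg_cong[OF phi4_w_P, of "\<lambda>f. f $ 0"] by (simp add: phi4_P_coeffs)
  show "phi4_w $ 1 = 1 / 2"
    using arg_cong[OF phi4_w_P, of "\<lambda>f. f $ 1"] 0 phi4_P_coeffs by simp
qed

text \<open>The three moment relations amount to a linear second-order equation for
  \<open>phi4_P 0\<close>, and w = 1 + 4 X P_0' / P_0 is essentially its logarithmic
  derivative.\<close>

lemma phi4_w_riccati:
  "4 * fps_X\<^sup>2 * fps_deriv phi4_w = 6 * (phi4_w - 1) - fps_X * (phi4_w\<^sup>2 + 2 * phi4_w)"
proof -
  let ?p = "phi4_P 0" and ?w = phi4_w and ?x = "fps_X :: real fps"
  have d0: "4 * ?x * fps_deriv ?p = ?p * ?w - ?p"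
    using phi4_P_0_deriv by (simp add: phi4_w_P)
  have d1: "4 * ?x * (fps_deriv ?p * ?w + ?p * fps_deriv ?w) = phi4_P 2 - 3 * (?p * ?w)"
    using phi4_P_1_deriv unfolding phi4_w_P[symmetric] by (simp add: algebra_simps)
  have d2: "?x * phi4_P 2 = 6 * (?p * ?w - ?p)"
    using X_phi4_P_2 unfolding phi4_w_P[symmetric] .
  have "?p * (4 * ?x\<^sup>2 * fps_deriv ?w) = ?p * (6 * (?w - 1) - ?x * (?w\<^sup>2 + 2 * ?w))"
    using d0 d1 d2 by algebra
  then show ?thesis using phi4_P_nz by (metis mult_left_cancel)
qed

section \<open>Passing from the bare coupling hbar to the renormalized coupling\<close>

definition phi4_F :: "real fps" where
  "phi4_F = fps_X * phi4_alpha"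

lemma phi4_F_0: "phi4_F $ 0 = 0" and phi4_F_1: "phi4_F $ 1 = 1"
  by (simp_all add: phi4_F_def phi4_alpha_0)

lemma phi4_alpha_w: "phi4_alpha = phi4_G4 * phi4_w\<^sup>2"
proof -
  have nz: "phi4_G2 $ 0 \<noteq> 0" "phi4_P 1 $ 0 \<noteq> 0" by (simp_all add: phi4_G2_0 phi4_P_coeffs)
  have dv: "phi4_P 1 dvd phi4_P 0"
    by (rule unit_imp_dvd) (simp add: phi4_P_coeffs)
  have "phi4_P 0 * (phi4_G2 * phi4_w) = phi4_G2 * phi4_P 1"
    by (metis phi4_w_P mult.left_commute)
  also have "\<dots> = phi4_P 0 * (- 1)" unfolding phi4_G2_eq using dv by simp
  finally have w: "phi4_G2 * phi4_w = - 1" using phi4_P_nz by (metis mult_left_cancel)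
  have "phi4_G2\<^sup>2 dvd phi4_G4"
    by (rule unit_imp_dvd) (simp add: phi4_G2_0 fps_power_zeroth)
  then have "phi4_alpha * phi4_G2\<^sup>2 = phi4_G4" by (simp add: phi4_alpha_eq)
  then have "phi4_G4 * phi4_w\<^sup>2 = phi4_alpha * (phi4_G2 * phi4_w)\<^sup>2"
    by (simp only: power_mult_distrib mult.assoc[symmetric])
  then show ?thesis by (simp add: w)
qed

text \<open>Here F is hbar_ren as a series in hbar. Since F = X G_4 w^2 and X G_4 w^4 = P_2/P_0 - 3
  w^2, the product X F w^2 equals X (P_2/P_0 - 3 w^2), and the Dyson-Schwinger relation rewrites X
  P_2/P_0 as 6 (w - 1). Thus hbar_ren is rational in hbar and w.\<close>

lemma phi4_F_w: "(phi4_F + 3) * fps_X * phi4_w\<^sup>2 = 6 * (phi4_w - 1)"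
proof -
  let ?p = "phi4_P 0" and ?w = phi4_w and ?x = "fps_X :: real fps"
  let ?A = "phi4_P 2 / ?p - 3 * ?w\<^sup>2"
  have nz: "phi4_P 0 $ 0 \<noteq> 0" by (simp add: phi4_P_coeffs)
  have A: "?A $ 0 = 0"
    using phi4_P_coeffs by (simp add: fps_divide_unit[OF nz] fps_power_zeroth phi4_w_0 numeral_fps_const)
  then have shift: "?x * fps_shift 1 ?A = ?A" by (intro fps_ext) (auto simp: fps_X_mult_nth)
  have dv: "phi4_P 0 dvd phi4_P 2" "phi4_P 1 dvd phi4_P 0"
    by (rule unit_imp_dvd, simp add: phi4_P_coeffs)+
  have "phi4_P 0 * (phi4_w * (phi4_P 0 / phi4_P 1)) = phi4_P 1 * (phi4_P 0 / phi4_P 1)"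
    by (simp only: phi4_w_P[symmetric] mult.assoc)
  also have "\<dots> = phi4_P 0 * 1" using dv by simp
  finally have inv: "phi4_w * (phi4_P 0 / phi4_P 1) = 1" using phi4_P_nz by (metis mult_left_cancel)
  have "phi4_G4 * ?w ^ 4 = fps_shift 1 ?A * (phi4_w * (phi4_P 0 / phi4_P 1)) ^ 4"
    unfolding phi4_G4_eq phi4_w_def[symmetric] by (simp only: power_mult_distrib mult_ac)
  then have G4: "?x * (phi4_G4 * ?w ^ 4) = ?A" by (simp only: inv shift power_one mult_1_right)
  have "phi4_P 2 = ?p * (phi4_P 2 / ?p)" using dv by simp
  moreover have "?x * phi4_P 2 = 6 * (?p * ?w - ?p)" using X_phi4_P_2 by (simp only: phi4_w_P)
  ultimately have "?p * (?x * (phi4_P 2 / ?p)) = ?p * (6 * (?w - 1))" by algebra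
  then have *: "?x * (phi4_P 2 / ?p) = 6 * (?w - 1)" using phi4_P_nz by (metis mult_left_cancel)
  have "?x * phi4_F * ?w\<^sup>2 = ?x * (?x * (phi4_G4 * ?w ^ 4))"
    unfolding phi4_F_def phi4_alpha_w by algebra
  also have "\<dots> = 6 * (?w - 1) - 3 * ?x * ?w\<^sup>2" unfolding G4 using * by (simp add: algebra_simps)
  finally show ?thesis by (simp add: algebra_simps)
qed

lemma phi4_F_hbar: "phi4_F oo phi4_hbar = fps_X"
  and phi4_hbar_F: "phi4_hbar oo phi4_F = fps_X"
proof -
  have nz: "phi4_F $ 1 \<noteq> 0" by (simp only: phi4_F_1)
  show F: "phi4_F oo phi4_hbar = fps_X"
    by (simp add: phi4_F_def fps_compose_mult_distrib fps_X_fps_compose_startby0 phi4_hbar)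
  have "phi4_hbar = (fps_inv phi4_F oo phi4_F) oo phi4_hbar"
    by (simp add: fps_inv[OF phi4_F_0 nz] fps_X_fps_compose_startby0 phi4_hbar)
  also have "\<dots> = fps_inv phi4_F oo (phi4_F oo phi4_hbar)"
    by (simp add: fps_compose_assoc phi4_hbar phi4_F_0)
  finally have "phi4_hbar = fps_inv phi4_F" by (simp add: F)
  then show "phi4_hbar oo phi4_F = fps_X" using fps_inv[OF phi4_F_0 nz] by (simp only:)
qed

text \<open>The factor X eliminates G_4: expressed in the bare coupling, s is F / G_4 = X
  w^2.\<close>

definition phi4_s :: "real fps" where
  "phi4_s = fps_X * phi4_z"

lemma phi4_s_0: "phi4_s $ 0 = 0" and phi4_s_1: "phi4_s $ 1 = 1"
proof -
  have "(phi4_G4 oo phi4_hbar) dvd 1" by (simp add: phi4_G4_0)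
  then have "phi4_z * (phi4_G4 oo phi4_hbar) = 1" unfolding phi4_z_def by simp
  from arg_cong[OF this, of "\<lambda>f. f $ 0"] have "phi4_z $ 0 = 1" by (simp add: phi4_G4_0)
  then show "phi4_s $ 0 = 0" "phi4_s $ 1 = 1" by (simp_all add: phi4_s_def)
qed

lemma phi4_s_F: "phi4_s oo phi4_F = fps_X * phi4_w\<^sup>2"
proof -
  have "(phi4_G4 oo phi4_hbar) dvd 1" by (simp add: phi4_G4_0)
  then have "phi4_z * (phi4_G4 oo phi4_hbar) = 1" unfolding phi4_z_def by simp
  then have "(phi4_z oo phi4_F) * ((phi4_G4 oo phi4_hbar) oo phi4_F) = 1 oo phi4_F"
    by (metis fps_compose_mult_distrib phi4_F_0)
  then have "(phi4_z oo phi4_F) * phi4_G4 = 1"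
    by (simp add: fps_compose_assoc[symmetric] phi4_F_0 phi4_hbar phi4_hbar_F)
  moreover have "phi4_s oo phi4_F = phi4_F * (phi4_z oo phi4_F)"
    by (simp add: phi4_s_def fps_compose_mult_distrib phi4_F_0 fps_X_fps_compose_startby0)
  ultimately show ?thesis by (simp add: phi4_F_def phi4_alpha_w) algebra
qed

text \<open>Pulled back along F, with S = X w^2, the relation (F + 3) S = 6 (w - 1) gives w, and
  hence X = S / w^2, in terms of F and S. The Riccati equation then turns into an equation in F, S
  and dS/dF alone; composition with \<open>phi4_hbar\<close> restores the variable.\<close>

lemma phi4_s_ode:
  "2 * (fps_X + 2) * phi4_s\<^sup>2 + (fps_X + 2) * (fps_X + 3) * phi4_s * fps_deriv phi4_s
    = 6 * fps_X * fps_deriv phi4_s" (is "?L = ?R")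
proof -
  let ?w = phi4_w and ?x = "fps_X :: real fps" and ?F = phi4_F
  let ?S = "phi4_s oo ?F" and ?D = "fps_deriv phi4_s oo ?F"
  let ?E = "2 * (?F + 2) * ?S\<^sup>2 + (?F + 2) * (?F + 3) * ?S * ?D - 6 * ?F * ?D"
  let ?v = "fps_deriv ?w" and ?f = "fps_deriv ?F"
  have S: "?S = ?x * ?w\<^sup>2" by (rule phi4_s_F)
  have FS: "(?F + 3) * ?x * ?w\<^sup>2 = 6 * (?w - 1)" by (rule phi4_F_w)
  have dS: "?D * ?f = ?w\<^sup>2 + 2 * ?x * ?w * ?v"
    using arg_cong[OF S, of fps_deriv] by (simp add: fps_compose_deriv phi4_F_0 power2_eq_square algebra_simps)
  have dFS: "?f * ?x * ?w\<^sup>2 + (?F + 3) * (?w\<^sup>2 + 2 * ?x * ?w * ?v) = 6 * ?v"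
    using arg_cong[OF FS, of fps_deriv] by (simp add: power2_eq_square algebra_simps)
  have ric: "4 * ?x\<^sup>2 * ?v = 6 * (?w - 1) - ?x * (?w\<^sup>2 + 2 * ?w)" by (rule phi4_w_riccati)
  have "?f * ?E = 2 * (?F + 2) * ?S\<^sup>2 * ?f + (?F + 2) * (?F + 3) * ?S * (?D * ?f) - 6 * ?F * (?D * ?f)"
    by (simp add: algebra_simps)
  also have "\<dots> = 2 * (?F + 2) * (?x * ?w\<^sup>2)\<^sup>2 * ?f
      + ((?F + 2) * (?F + 3) * (?x * ?w\<^sup>2) - 6 * ?F) * (?w\<^sup>2 + 2 * ?x * ?w * ?v)"
    unfolding dS S by (simp add: algebra_simps)
  finally have 1: "?f * ?E = \<dots>" .
  \<comment> \<open>The factor F' converts derivatives with respect to F into derivatives with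
    respect to X; the additional factor X is there because the Riccati equation gives access only to
    X^2 w'.\<close>
  have "?x * (?f * ?E) = 0" unfolding 1 using FS dFS ric by algebra
  moreover have "?f \<noteq> 0"
  proof
    assume "?f = 0"
    from arg_cong[OF this, of "\<lambda>f. f $ 0"] show False using phi4_F_1 by simp
  qed
  ultimately have E: "?E = 0" by simp
  have "(?L - ?R) oo ?F = ?E"
    by (simp add: fps_compose_mult_distrib fps_compose_add_distrib fps_compose_sub_distrib phi4_F_0
      fps_X_fps_compose_startby0 power2_eq_square numeral_fps_const)
  then have "((?L - ?R) oo ?F) oo phi4_hbar = 0" using E by simp
  then have "?L - ?R = 0"
    by (simp add: fps_compose_assoc[symmetric] phi4_F_0 phi4_hbar phi4_F_hbar)
  then show ?thesis by simp
qed

text \<open>Doubling the equation turns s s' into the derivative of s^2, so that the nonlinearity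
  enters only through the coefficients of one square.\<close>

lemma phi4_s_rec:
  assumes "n \<ge> 1"
  shows "12 * real n * phi4_s $ n = 6 * (real n + 1) * (phi4_s\<^sup>2) $ (n + 1)
    + (5 * real n + 8) * (phi4_s\<^sup>2) $ n + (real n + 3) * (phi4_s\<^sup>2) $ (n - 1)"
proof -
  obtain m where m: "n = Suc m" using assms by (cases n) auto
  define q where "q = phi4_s\<^sup>2"
  have dq: "fps_deriv q = 2 * phi4_s * fps_deriv phi4_s"
    by (simp add: q_def power2_eq_square algebra_simps)
  have "4 * (fps_X + 2) * q + (fps_X + 2) * (fps_X + 3) * fps_deriv q
      = 12 * (fps_X * fps_deriv phi4_s)"
    using phi4_s_ode unfolding dq unfolding q_def by algebra
  moreover have "4 * (fps_X + 2) * q + (fps_X + 2) * (fps_X + 3) * fps_deriv q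
      = 4 * (fps_X * q) + 8 * q + fps_X * (fps_X * fps_deriv q) + 5 * (fps_X * fps_deriv q) + 6 * fps_deriv q"
    by (simp add: algebra_simps)
  ultimately have "(4 * (fps_X * q) + 8 * q + fps_X * (fps_X * fps_deriv q)
      + 5 * (fps_X * fps_deriv q) + 6 * fps_deriv q) $ n = (12 * (fps_X * fps_deriv phi4_s)) $ n"
    by simp
  then have "4 * q $ m + 8 * q $ n + real m * q $ m + 5 * (real n * q $ n) + 6 * (real (n + 1) * q $ (n + 1))
      = 12 * (real n * phi4_s $ n)"
    by (simp only: fps_add_nth fps_numeral_fps_const fps_mult_left_const_nth fps_X_mult_deriv_nth m
        fps_X_mult_nth nat.simps diff_Suc_1 if_False fps_deriv_nth Suc_eq_plus1 semiring_1_class.of_nat_0)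
       (cases "m = 0"; simp)
  then show ?thesis unfolding q_def[symmetric] by (simp add: m algebra_simps)
qed

text \<open>Because s_1 = 1, the square at n + 1 contributes 12 (n+1) s_n, which exceeds the left
  side by 12 s_n; hence the recurrence determines s_n for n >= 2. Values up to s_6 are what the
  coefficients of the expansion up to c_3 require.\<close>

lemma phi4_s_coeffs:
  "phi4_s $ 2 = - 3 / 2" "phi4_s $ 3 = 3 / 4" "phi4_s $ 4 = - 11 / 8"
  "phi4_s $ 5 = - 45 / 16" "phi4_s $ 6 = - 499 / 32"
proof -
  have s0: "phi4_s $ 0 = 0" "phi4_s $ Suc 0 = 1" using phi4_s_0 phi4_s_1 by simp_all
  note R = s0 fps_mult_nth[of phi4_s phi4_s] atLeast0_atMost_Suc eval_nat_numeral
  have 2: "phi4_s $ Suc (Suc 0) = - 3 / 2"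
    using phi4_s_rec[of 2] by (simp add: R )
  have 3: "phi4_s $ Suc (Suc (Suc 0)) = 3 / 4"
    using phi4_s_rec[of 3] by (simp add: R 2)
  have 4: "phi4_s $ Suc (Suc (Suc (Suc 0))) = - 11 / 8"
    using phi4_s_rec[of 4] by (simp add: R 2 3)
  have 5: "phi4_s $ Suc (Suc (Suc (Suc (Suc 0)))) = - 45 / 16"
    using phi4_s_rec[of 5] by (simp add: R 2 3 4)
  have 6: "phi4_s $ Suc (Suc (Suc (Suc (Suc (Suc 0))))) = - 499 / 32"
    using phi4_s_rec[of 6] by (simp add: R 2 3 4 5)
  show "phi4_s $ 2 = - 3 / 2" "phi4_s $ 3 = 3 / 4" "phi4_s $ 4 = - 11 / 8"
    "phi4_s $ 5 = - 45 / 16" "phi4_s $ 6 = - 499 / 32"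
    using 2 3 4 5 6 by (simp_all add: eval_nat_numeral)
qed

text \<open>This value fixes the Moebius substitution and thereby the exponent 15/4.\<close>

lemma phi4_F_2: "phi4_F $ 2 = 5 / 2"
proof -
  have "(phi4_s oo phi4_F) $ 2 = phi4_F $ 2 + phi4_s $ 2"
    using phi4_s_0 phi4_s_1 phi4_F_0 phi4_F_1
    by (simp add: fps_compose_nth power2_eq_square fps_mult_nth atLeast0_atMost_Suc eval_nat_numeral)
  moreover have "(fps_X * phi4_w\<^sup>2) $ 2 = 1"
    using phi4_w_0 phi4_w_1
    by (simp add: fps_X_mult_nth power2_eq_square)
  ultimately show ?thesis by (simp add: phi4_s_F phi4_s_coeffs)
qed

section \<open>Power series with factorially growing coefficients\<close>

definition gfac :: "real \<Rightarrow> nat \<Rightarrow> real" where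
  "gfac a n = a ^ n * fact n"

lemma gfac_pos: "a > 0 \<Longrightarrow> gfac a n > 0"
  by (simp add: gfac_def)

lemma gfac_nz: "a > 0 \<Longrightarrow> gfac a n \<noteq> 0"
  by (simp add: gfac_def)

lemma gfac_Suc: "gfac a (Suc n) = a * (real n + 1) * gfac a n"
  by (simp add: gfac_def algebra_simps)

text \<open>Since i! (n-i)! is n! divided by a binomial coefficient, this is unimodality of a row of
  Pascal's triangle.\<close>

lemma fact_mult_fact_le:
  assumes "c \<le> i" "i + c \<le> n"
  shows "(fact i * fact (n - i) :: real) \<le> fact c * fact (n - c)"
proof -
  have "n choose c \<le> n choose i"
  proof (cases "2 * i \<le> n")
    case True
    then show ?thesis using assms by (intro binomial_mono)
  next
    case False
    then have "n choose c \<le> n choose (n - i)" using assms by (intro binomial_mono) auto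
    then show ?thesis using assms binomial_symmetric[of i n] by simp
  qed
  moreover have "fact c * fact (n - c) * (n choose c) = (fact n :: nat)"
    "fact i * fact (n - i) * (n choose i) = (fact n :: nat)"
    using assms by (auto intro!: binomial_fact_lemma)
  ultimately have "fact i * fact (n - i) * (n choose c) \<le> fact c * fact (n - c) * (n choose c)"
    by (metis mult_le_mono2)
  moreover have "n choose c > 0" using assms by simp
  ultimately have "fact i * fact (n - i) \<le> (fact c * fact (n - c) :: nat)" by simp
  then have "real (fact i * fact (n - i)) \<le> real (fact c * fact (n - c))" by (rule of_nat_mono)
  then show ?thesis by (simp only: of_nat_mult of_nat_fact)
qed

text \<open>The two end terms cost at most c! (n-c)! each. Fewer than n-c terms lie strictly between
  them, each at most (c+1)! (n-c-1)!, so together they cost (c+1)! (n-c)!.\<close>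

lemma sum_fact_mult_fact_le:
  "(\<Sum>i=c..n-c. fact i * fact (n - i) :: real) \<le> (2 * fact c + fact (c + 1)) * fact (n - c)"
proof (cases "2 * c \<le> n")
  case False
  then have "n < 2 * c" by simp
  show ?thesis
  proof (cases "c \<le> n - c")
    case True
    then have "c = 0" using False by linarith
    then show ?thesis using False by simp
  next
    case False
    then show ?thesis by (simp add: add_nonneg_nonneg)
  qed
next
  case True
  let ?f = "\<lambda>i. fact i * fact (n - i) :: real"
  have eq: "{c..n-c} = {c, n - c} \<union> {c+1..<n-c}" using True by auto
  have "sum ?f {c..n-c} = sum ?f {c, n - c} + sum ?f {c+1..<n-c}"
    unfolding eq by (rule sum.union_disjoint) auto
  moreover have "sum ?f {c, n - c} \<le> 2 * (fact c * fact (n - c))"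
  proof -
    have "sum ?f {c, n - c} \<le> of_nat (card {c, n - c}) * (fact c * fact (n - c))"
      using True by (intro sum_bounded_above) auto
    also have "\<dots> \<le> 2 * (fact c * fact (n - c))"
      by (intro mult_right_mono) (auto simp: card_insert_if)
    finally show ?thesis .
  qed
  moreover have "sum ?f {c+1..<n-c} \<le> fact (c + 1) * fact (n - c)"
  proof (cases "c + 1 < n - c")
    case False
    then show ?thesis by simp
  next
    case less: True
    have "sum ?f {c+1..<n-c} \<le> of_nat (card {c+1..<n-c}) * (fact (c + 1) * fact (n - (c + 1)))"
      using less by (intro sum_bounded_above fact_mult_fact_le) auto
    also have "\<dots> \<le> real (n - c) * (fact (c + 1) * fact (n - (c + 1)))"
      by (intro mult_right_mono) auto
    also have "\<dots> = fact (c + 1) * (real (n - c) * fact (n - c - 1))" by simp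
    also have "\<dots> = fact (c + 1) * fact (n - c)" using less fact_reduce[of "n - c", where 'a = real] by (simp del: of_nat_diff)
    finally show ?thesis .
  qed
  ultimately show ?thesis by (simp add: algebra_simps)
qed

definition conv_const :: "real \<Rightarrow> nat \<Rightarrow> real" where
  "conv_const a c = (2 * fact c + fact (c + 1)) * a ^ c"

lemma conv_const_nonneg: "a > 0 \<Longrightarrow> conv_const a c \<ge> 0"
  by (simp add: conv_const_def add_nonneg_nonneg)

lemma sum_gfac_mult_gfac_le:
  assumes "a > 0"
  shows "(\<Sum>i=c..n-c. gfac a i * gfac a (n - i)) \<le> conv_const a c * gfac a (n - c)"
proof (cases "c \<le> n")
  case True
  have "(\<Sum>i=c..n-c. gfac a i * gfac a (n - i)) = (\<Sum>i=c..n-c. a ^ n * (fact i * fact (n - i)))"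
    by (rule sum.cong) (auto simp: gfac_def power_add[symmetric] algebra_simps)
  also have "\<dots> \<le> a ^ n * ((2 * fact c + fact (c + 1)) * fact (n - c))"
    unfolding sum_distrib_left[symmetric]
    using assms by (intro mult_left_mono sum_fact_mult_fact_le) auto
  also have "a ^ n = a ^ c * a ^ (n - c)" using True by (simp add: power_add[symmetric])
  finally show ?thesis by (simp add: conv_const_def gfac_def algebra_simps)
next
  case False
  then show ?thesis
    using conv_const_nonneg[OF assms] gfac_pos[OF assms] by (simp add: less_imp_le)
qed

text \<open>Shifting both indices by b reduces the sum to a convolution of the pure scale with
  cutoff c + b. The gain is that c omitted terms at each end save c steps of the factorial.\<close>

lemma middle_bound:
  assumes a: "a > 0" and "K \<ge> 0" "H \<ge> 0"
    and f: "\<And>i. c \<le> i \<Longrightarrow> i \<le> n - c \<Longrightarrow> \<bar>f i\<bar> \<le> K * gfac a (i + b)"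
    and h: "\<And>i. c \<le> i \<Longrightarrow> i \<le> n - c \<Longrightarrow> \<bar>h (n - i)\<bar> \<le> H * gfac a (n - i + b)"
  shows "\<bar>\<Sum>i=c..n-c. f i * h (n - i)\<bar> \<le> K * H * conv_const a (c + b) * gfac a (n - c + b)"
proof (cases "c \<le> n")
  case False
  then show ?thesis using assms gfac_pos[OF a] conv_const_nonneg[OF a] by (simp add: less_imp_le)
next
  case True
  have "\<bar>\<Sum>i=c..n-c. f i * h (n - i)\<bar> \<le> (\<Sum>i=c..n-c. \<bar>f i\<bar> * \<bar>h (n - i)\<bar>)"
    by (rule order_trans[OF sum_abs]) (simp add: abs_mult)
  also have "\<dots> \<le> (\<Sum>i=c..n-c. (K * gfac a (i + b)) * (H * gfac a (n - i + b)))"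
    using f h assms by (intro sum_mono mult_mono) (auto simp: gfac_pos less_imp_le)
  also have "\<dots> = K * H * (\<Sum>i=c..n-c. gfac a (i + b) * gfac a (n + 2 * b - (i + b)))"
    unfolding sum_distrib_left by (intro sum.cong) (auto simp: algebra_simps)
  also have "(\<Sum>i=c..n-c. gfac a (i + b) * gfac a (n + 2 * b - (i + b)))
      = (\<Sum>i=c+b..(n-c)+b. gfac a i * gfac a (n + 2 * b - i))"
    by (rule sum.shift_bounds_cl_nat_ivl[symmetric])
  also have "(n - c) + b = n + 2 * b - (c + b)" using True by simp
  also have "K * H * (\<Sum>i=c+b..n + 2 * b - (c + b). gfac a i * gfac a (n + 2 * b - i))
      \<le> K * H * (conv_const a (c + b) * gfac a (n + 2 * b - (c + b)))"
    using assms by (intro mult_left_mono sum_gfac_mult_gfac_le) auto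
  also have "n + 2 * b - (c + b) = n - c + b" using True by simp
  finally show ?thesis by (simp add: mult.assoc)
qed

section \<open>Series bounded by the factorial scale and their leading coefficients\<close>

definition fps_bdd :: "real \<Rightarrow> nat \<Rightarrow> real fps \<Rightarrow> bool" where
  "fps_bdd a b f \<longleftrightarrow> (\<exists>K\<ge>0. \<forall>n. \<bar>f $ n\<bar> \<le> K * gfac a (n + b))"

definition fps_lim :: "real \<Rightarrow> nat \<Rightarrow> real fps \<Rightarrow> real \<Rightarrow> bool" where
  "fps_lim a b f L \<longleftrightarrow> (\<lambda>n. f $ n / gfac a (n + b)) \<longlonglongrightarrow> L"

lemma fps_bddI:
  assumes "a > 0" "Bseq (\<lambda>n. f $ n / gfac a (n + b))"
  shows "fps_bdd a b f"
proof -
  obtain K where "K > 0" "\<And>n. norm (f $ n / gfac a (n + b)) \<le> K"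
    using assms(2) by (auto elim: BseqE)
  moreover have "\<bar>f $ n\<bar> \<le> K * gfac a (n + b)" if "norm (f $ n / gfac a (n + b)) \<le> K" for n
    using that gfac_pos[OF assms(1), of "n + b"] by (simp add: abs_divide pos_divide_le_eq)
  ultimately show ?thesis unfolding fps_bdd_def by (intro exI[of _ K]) auto
qed

lemma fps_lim_imp_bdd: "a > 0 \<Longrightarrow> fps_lim a b f L \<Longrightarrow> fps_bdd a b f"
  by (intro fps_bddI convergent_imp_Bseq) (auto simp: fps_lim_def convergent_def)

lemma gfac_ratio_tendsto_0:
  assumes "a > 0"
  shows "(\<lambda>n. gfac a (n - 1 + b) / gfac a (n + b)) \<longlonglongrightarrow> 0"
proof (rule Lim_transform_eventually)
  show "(\<lambda>n. (1 / a) * (1 / real (n + b))) \<longlonglongrightarrow> 0"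
    using LIMSEQ_ignore_initial_segment[OF lim_1_over_n[where 'a = real], of b]
    by (intro tendsto_mult_right_zero) simp
  show "eventually (\<lambda>n. (1 / a) * (1 / real (n + b)) = gfac a (n - 1 + b) / gfac a (n + b)) sequentially"
    using eventually_gt_at_top[of 0]
  proof eventually_elim
    case (elim n)
    then obtain m where m: "n = Suc m" by (cases n) auto
    show ?case using gfac_pos[OF assms, of "m + b"] assms by (simp add: m gfac_Suc)
  qed
qed

lemma gfac_small_tendsto_0:
  assumes "a > 0" and "\<And>n. n \<ge> N \<Longrightarrow> \<bar>x n\<bar> \<le> C * gfac a (n - 1 + b)"
  shows "(\<lambda>n. x n / gfac a (n + b)) \<longlonglongrightarrow> 0"
proof (rule Lim_null_comparison)
  show "(\<lambda>n. C * (gfac a (n - 1 + b) / gfac a (n + b))) \<longlonglongrightarrow> 0"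
    by (intro tendsto_mult_right_zero gfac_ratio_tendsto_0 assms)
  show "\<forall>\<^sub>F n in sequentially. norm (x n / gfac a (n + b)) \<le> C * (gfac a (n - 1 + b) / gfac a (n + b))"
    using eventually_ge_at_top[of N]
  proof eventually_elim
    case (elim n)
    then show ?case using assms(2)[OF elim] gfac_pos[OF assms(1), of "n + b"]
      by (simp add: abs_divide divide_right_mono)
  qed
qed

lemma fps_mult_nth_split:
  assumes "n \<ge> 2"
  shows "(f * h) $ n = f $ 0 * h $ n + f $ n * h $ 0 + (\<Sum>i=1..n-1. f $ i * h $ (n - i))"
proof -
  have "{0..n} = insert 0 (insert n {1..n-1})" using assms by auto
  then show ?thesis using assms by (simp add: fps_mult_nth add_ac)
qed

text \<open>With the two extreme terms of the Cauchy product removed, both factors have index at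
  least 1, which saves one step of the factorial. Therefore the leading coefficient behaves as a
  derivation weighted by constant terms.\<close>

lemma fps_mult_middle_tendsto_0:
  assumes a: "a > 0" and "fps_bdd a b f" "fps_bdd a b h"
  shows "(\<lambda>n. ((f * h) $ n - f $ 0 * h $ n - f $ n * h $ 0) / gfac a (n + b)) \<longlonglongrightarrow> 0"
proof -
  obtain K H where K: "K \<ge> 0" "\<And>n. \<bar>f $ n\<bar> \<le> K * gfac a (n + b)"
    and H: "H \<ge> 0" "\<And>n. \<bar>h $ n\<bar> \<le> H * gfac a (n + b)"
    using assms(2,3) unfolding fps_bdd_def by blast
  show ?thesis
  proof (rule gfac_small_tendsto_0[OF a])
    fix n :: nat assume "n \<ge> 2"
    then show "\<bar>(f * h) $ n - f $ 0 * h $ n - f $ n * h $ 0\<bar>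
        \<le> (K * H * conv_const a (1 + b)) * gfac a (n - 1 + b)"
      unfolding fps_mult_nth_split[OF \<open>n \<ge> 2\<close>]
      using middle_bound[where f = "\<lambda>i. f $ i" and h = "\<lambda>i. h $ i" and c = 1 and n = n, OF a K(1) H(1) K(2) H(2)]
      by (simp only: add_diff_cancel_left' diff_diff_eq add_diff_cancel_right')
  qed
qed

lemma fps_lim_mult:
  assumes a: "a > 0" and f: "fps_lim a b f L" and h: "fps_lim a b h M"
  shows "fps_lim a b (f * h) (f $ 0 * M + h $ 0 * L)"
proof -
  note b = fps_lim_imp_bdd[OF a f] fps_lim_imp_bdd[OF a h]
  have "(\<lambda>n. ((f * h) $ n - f $ 0 * h $ n - f $ n * h $ 0) / gfac a (n + b)
      + f $ 0 * (h $ n / gfac a (n + b)) + h $ 0 * (f $ n / gfac a (n + b))) \<longlonglongrightarrow> 0 + f $ 0 * M + h $ 0 * L"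
    using f h unfolding fps_lim_def
    by (intro tendsto_add tendsto_mult_left fps_mult_middle_tendsto_0 a b)
  then show ?thesis by (simp add: fps_lim_def diff_divide_distrib mult.commute)
qed

lemma fps_lim_diff: "fps_lim a b f L \<Longrightarrow> fps_lim a b h M \<Longrightarrow> fps_lim a b (f - h) (L - M)"
  by (simp add: fps_lim_def diff_divide_distrib tendsto_diff)

lemma fps_lim_finite:
  assumes "\<And>n. n \<ge> N \<Longrightarrow> f $ n = 0"
  shows "fps_lim a b f 0"
  unfolding fps_lim_def
  by (intro tendsto_eventually eventually_mono[OF eventually_ge_at_top[of N]]) (simp add: assms)

lemma fps_lim_const: "fps_lim a b (fps_const c) 0"
  by (rule fps_lim_finite[of 1]) auto

lemma fps_lim_numeral: "fps_lim a b (numeral k) 0"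
  by (simp add: numeral_fps_const fps_lim_const)

lemma fps_lim_X: "fps_lim a b fps_X 0"
  by (rule fps_lim_finite[of 2]) auto

text \<open>If earlier values enter only with a factor 1/n, a bound H >= 2 A reproduces itself as
  soon as n >= 2 B, because then A + B H / n <= H/2 + H/2. The finitely many smaller n are absorbed
  in H.\<close>

lemma bootstrap_bound:
  fixes x :: "nat \<Rightarrow> real"
  assumes step: "\<And>n H. n \<ge> N \<Longrightarrow> H \<ge> 0 \<Longrightarrow> (\<And>m. m < n \<Longrightarrow> x m \<le> H) \<Longrightarrow> x n \<le> A + B * H / real n"
  shows "\<exists>H\<ge>0. \<forall>n. x n \<le> H"
proof -
  define k where "k = Max {N, 1, nat \<lceil>2 * B\<rceil>}"
  have k: "k \<ge> N" "k \<ge> 1" "real k \<ge> 2 * B"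
    unfolding k_def by (auto simp: Max_ge_iff le_max_iff_disj intro: order_trans[OF real_nat_ceiling_ge])
  define H where "H = Max (insert 0 (insert (2 * A) (x ` {..<k})))"
  have H: "H \<ge> 0" "H \<ge> 2 * A" "\<And>m. m < k \<Longrightarrow> x m \<le> H" unfolding H_def by (rule Max_ge; simp)+
  have "x n \<le> H" for n
  proof (induction n rule: less_induct)
    case (less n)
    show ?case
    proof (cases "n < k")
      case False
      then have n: "n \<ge> N" "real n \<ge> 2 * B" "real n > 0" using k by auto
      have "x n \<le> A + B * H / real n" using less H n by (intro step) auto
      also have "B * H / real n \<le> H / 2"
      proof -
        have "2 * B * H \<le> real n * H" using n H by (intro mult_right_mono) auto
        then show ?thesis using n by (simp add: field_simps)
      qed
      finally show ?thesis using H by linarith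
    qed (use H in auto)
  qed
  with H(1) show ?thesis by blast
qed

text \<open>The n-th coefficient of f / f = 1, solved for the top coefficient of the inverse, leaves
  a middle convolution. It involves only earlier coefficients and is smaller by a factor 1/n, as the
  bootstrap demands.\<close>

lemma fps_bdd_inverse:
  fixes f :: "real fps"
  assumes a: "a > 0" and f: "fps_bdd a b f" and f0: "f $ 0 \<noteq> 0"
  shows "fps_bdd a b (inverse f)"
proof -
  let ?h = "inverse f"
  obtain K where K: "K \<ge> 0" "\<And>n. \<bar>f $ n\<bar> \<le> K * gfac a (n + b)"
    using f unfolding fps_bdd_def by blast
  let ?c = "conv_const a (1 + b)" and ?g = "\<lambda>n. gfac a (n + b)"
  have "\<exists>H\<ge>0. \<forall>n. \<bar>?h $ n\<bar> / ?g n \<le> H"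
  proof (rule bootstrap_bound)
    fix n H assume n: "n \<ge> (2::nat)" and H: "H \<ge> (0::real)" and less: "\<And>m. m < n \<Longrightarrow> \<bar>?h $ m\<bar> / ?g m \<le> H"
    have g: "?g m > 0" for m using gfac_pos[OF a] .
    have gn: "?g n = a * (real n + real b) * gfac a (n - 1 + b)"
      using n by (cases n) (auto simp: gfac_Suc algebra_simps)
    have "(f * ?h) $ n = 0" using f0 n by (simp add: inverse_mult_eq_1')
    then have "f $ 0 * ?h $ n = - (f $ n * ?h $ 0) - (\<Sum>i=1..n-1. f $ i * ?h $ (n - i))"
      using n by (simp only: fps_mult_nth_split)
    then have "\<bar>f $ 0\<bar> * \<bar>?h $ n\<bar> \<le> \<bar>f $ n\<bar> * \<bar>?h $ 0\<bar> + \<bar>\<Sum>i=1..n-1. f $ i * ?h $ (n - i)\<bar>"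
      by (simp only: abs_mult[symmetric])
    also have "\<dots> \<le> K * ?g n * \<bar>?h $ 0\<bar> + K * H * ?c * gfac a (n - 1 + b)"
    proof (intro add_mono mult_right_mono middle_bound[OF a K(1) H] K)
      fix i assume "1 \<le> i" "i \<le> n - 1"
      then show "\<bar>?h $ (n - i)\<bar> \<le> H * gfac a (n - i + b)"
        using less[of "n - i"] g[of "n - i"] n by (simp add: divide_le_eq)
    qed auto
    also have "gfac a (n - 1 + b) \<le> ?g n / (a * real n)"
      using a n gfac_pos[OF a, of "n - 1 + b"] unfolding gn by (simp add: field_simps)
    finally have "\<bar>f $ 0\<bar> * \<bar>?h $ n\<bar> \<le> K * ?g n * \<bar>?h $ 0\<bar> + K * H * ?c * (?g n / (a * real n))"
      using K H conv_const_nonneg[OF a] by (simp add: mult_left_mono)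
    also have "\<dots> = ?g n * \<bar>f $ 0\<bar> * (K * \<bar>?h $ 0\<bar> / \<bar>f $ 0\<bar> + (K * ?c / (a * \<bar>f $ 0\<bar>)) * H / real n)"
      using f0 a n by (simp add: field_simps)
    finally have "\<bar>f $ 0\<bar> * \<bar>?h $ n\<bar>
        \<le> \<bar>f $ 0\<bar> * (?g n * (K * \<bar>?h $ 0\<bar> / \<bar>f $ 0\<bar> + (K * ?c / (a * \<bar>f $ 0\<bar>)) * H / real n))"
      by (simp only: mult_ac)
    then have "\<bar>?h $ n\<bar> \<le> ?g n * (K * \<bar>?h $ 0\<bar> / \<bar>f $ 0\<bar> + (K * ?c / (a * \<bar>f $ 0\<bar>)) * H / real n)"
      by (rule mult_left_le_imp_le) (use f0 in simp)
    then show "\<bar>?h $ n\<bar> / ?g n \<le> K * \<bar>?h $ 0\<bar> / \<bar>f $ 0\<bar> + (K * ?c / (a * \<bar>f $ 0\<bar>)) * H / real n"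
      using g[of n] by (simp only: pos_divide_le_eq mult.commute[of _ "?g n"])
  qed
  then obtain H where "H \<ge> 0" "\<And>n. \<bar>?h $ n\<bar> / ?g n \<le> H" by blast
  then show ?thesis unfolding fps_bdd_def
    using gfac_pos[OF a] by (intro exI[of _ H]) (auto simp: divide_le_eq)
qed

lemma fps_lim_inverse:
  fixes f :: "real fps"
  assumes a: "a > 0" and f: "fps_lim a b f L" and f0: "f $ 0 = 1"
  shows "fps_lim a b (inverse f) (- L)"
proof -
  let ?h = "inverse f"
  have f0': "f $ 0 \<noteq> 0" using f0 by simp
  have b: "fps_bdd a b f" by (rule fps_lim_imp_bdd[OF a f])
  have "(\<lambda>n. - (((f * ?h) $ n - f $ 0 * ?h $ n - f $ n * ?h $ 0) / gfac a (n + b))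
      - f $ n / gfac a (n + b)) \<longlonglongrightarrow> - 0 - L"
    using f unfolding fps_lim_def
    by (intro tendsto_diff tendsto_minus fps_mult_middle_tendsto_0 a b fps_bdd_inverse[OF a b f0'])
  moreover have "eventually (\<lambda>n. - (((f * ?h) $ n - f $ 0 * ?h $ n - f $ n * ?h $ 0) / gfac a (n + b))
      - f $ n / gfac a (n + b) = ?h $ n / gfac a (n + b)) sequentially"
    using eventually_gt_at_top[of 0]
    by eventually_elim (simp add: inverse_mult_eq_1'[OF f0'] f0 diff_divide_distrib)
  ultimately show ?thesis unfolding fps_lim_def
    using Lim_transform_eventually by fastforce
qed

lemma fps_lim_raise:
  assumes "a > 0" "fps_lim a b f L"
  shows "fps_lim a (Suc b) f 0"
proof -
  have "(\<lambda>n. gfac a (n - 1 + Suc b) / gfac a (n + Suc b)) \<longlonglongrightarrow> 0"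
    by (rule gfac_ratio_tendsto_0[OF assms(1)])
  then have "(\<lambda>n. f $ n / gfac a (n + b) * (gfac a (n - 1 + Suc b) / gfac a (n + Suc b))) \<longlonglongrightarrow> L * 0"
    using assms(2) unfolding fps_lim_def by (intro tendsto_mult)
  moreover have "eventually (\<lambda>n. f $ n / gfac a (n + b) * (gfac a (n - 1 + Suc b) / gfac a (n + Suc b))
      = f $ n / gfac a (n + Suc b)) sequentially"
    using eventually_gt_at_top[of 0]
  proof eventually_elim
    case (elim n)
    then have "n - 1 + Suc b = n + b" by simp
    then show ?case using gfac_nz[OF assms(1), of "n + b"] by simp
  qed
  ultimately show ?thesis unfolding fps_lim_def by (simp add: Lim_transform_eventually)
qed

lemma fps_lim_X_mult_cancel:
  assumes "fps_lim a b (fps_X * f) L"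
  shows "fps_lim a (Suc b) f L"
  using LIMSEQ_Suc[OF assms[unfolded fps_lim_def]] by (simp add: fps_lim_def)

section \<open>Composition of factorially divergent power series\<close>

lemma moebius_power_nth:
  fixes c :: real
  assumes "n \<ge> 1"
  shows "((fps_X * inverse (1 - fps_const c * fps_X)) ^ k) $ n =
    (if 1 \<le> k \<and> k \<le> n then real ((n - 1) choose (n - k)) * c ^ (n - k) else 0)"
proof (cases "k = 0")
  case True
  then show ?thesis using assms by simp
next
  case False
  have "(fps_X * inverse (1 - fps_const c * fps_X)) ^ k
      = fps_X ^ k * inverse ((1 - fps_const c * fps_X) ^ k)"
    by (simp add: power_mult_distrib fps_inverse_power)
  also have "inverse ((1 - fps_const c * fps_X) ^ k)
      = Abs_fps (\<lambda>j. of_nat ((k + j - 1) choose j) * c ^ j)"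
    using False by (intro one_minus_const_fps_X_neg_power') simp
  finally show ?thesis using False by (auto simp: fps_X_power_mult_nth)
qed

lemma compose_moebius_nth:
  fixes c :: real
  assumes "n \<ge> 1"
  shows "(f oo (fps_X * inverse (1 - fps_const c * fps_X))) $ n
    = (\<Sum>j<n. f $ (n - j) * (real ((n - 1) choose j) * c ^ j))"
proof -
  have "(f oo (fps_X * inverse (1 - fps_const c * fps_X))) $ n
      = (\<Sum>k=0..n. f $ k * (if 1 \<le> k \<and> k \<le> n then real ((n - 1) choose (n - k)) * c ^ (n - k) else 0))"
    by (simp only: fps_compose_nth moebius_power_nth[OF assms])
  also have "\<dots> = (\<Sum>k\<in>{1..n}. f $ k * (real ((n - 1) choose (n - k)) * c ^ (n - k)))"
    by (rule sum.mono_neutral_cong_right) auto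
  also have "\<dots> = (\<Sum>j<n. f $ (n - j) * (real ((n - 1) choose j) * c ^ j))"
    by (rule sum.reindex_bij_witness[of _ "\<lambda>j. n - j" "\<lambda>k. n - k"]) auto
  finally show ?thesis .
qed

lemma gfac_diff_mult_choose:
  assumes "a > 0" "j < n"
  shows "gfac a (n - j) * real ((n - 1) choose j) = gfac a n * (real (n - j) / (real n * (a ^ j * fact j)))"
proof -
  have pow: "a ^ n = a ^ (n - j) * a ^ j" using assms by (simp add: power_add[symmetric])
  have 1: "real ((n - 1) choose j) = fact (n - 1) / (fact j * fact (n - 1 - j))"
    using assms by (intro binomial_fact) auto
  have 2: "(fact n :: real) = real n * fact (n - 1)" "(fact (n - j) :: real) = real (n - j) * fact (n - 1 - j)"
    using assms fact_reduce[of n, where 'a = real] fact_reduce[of "n - j", where 'a = real]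
    by (auto simp del: of_nat_diff simp: diff_right_commute)
  show ?thesis unfolding gfac_def 1 2 pow using assms by (simp add: divide_simps)
qed

text \<open>The exponential factor comes from
  \<open>f\<^sub>n\<^sub>-\<^sub>j (n - 1 choose j) c\<^sup>j \<approx> f\<^sub>n (c / a)\<^sup>j / j!\<close>.\<close>

lemma fps_lim_compose_moebius:
  fixes c :: real
  assumes a: "a > 0" and f: "fps_lim a 0 f L"
  shows "fps_lim a 0 (f oo (fps_X * inverse (1 - fps_const c * fps_X))) (L * exp (c / a))"
proof -
  define p where "p = (\<lambda>n. f $ n / gfac a n)"
  define x where "x = c / a"
  \<comment> \<open>Truncated subtraction makes the last factor zero for j >= n. The finite sum for
    the n-th coefficient is therefore an infinite series in j, to which dominated convergence
    applies with an exponential majorant.\<close>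
  define t where "t = (\<lambda>j n. p (n - j) * (x ^ j / fact j) * (real (n - j) / real n))"
  have p: "p \<longlonglongrightarrow> L" using f by (simp add: fps_lim_def p_def)
  then have "Bseq p" by (intro convergent_imp_Bseq) (auto simp: convergent_def)
  then obtain K where K: "\<And>n. \<bar>p n\<bar> \<le> K" unfolding Bseq_def real_norm_def by blast
  have K0: "K \<ge> 0" using K[of 0] by linarith
  have exp_sums: "(\<lambda>j. y ^ j / fact j) sums exp y" for y :: real
    using exp_converges[of y] by (simp add: field_simps)
  have lim: "(\<lambda>n. t j n) \<longlonglongrightarrow> L * (x ^ j / fact j) * 1" for j
    unfolding t_def
  proof (intro tendsto_mult tendsto_const)
    show "(\<lambda>n. p (n - j)) \<longlonglongrightarrow> L"
      using p by (simp add: filterlim_compose[OF _ filterlim_minus_const_nat_at_top])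
    show "(\<lambda>n. real (n - j) / real n) \<longlonglongrightarrow> 1"
    proof (rule Lim_transform_eventually)
      show "(\<lambda>n. 1 - real j * (1 / real n)) \<longlonglongrightarrow> 1"
        by (rule tendsto_eq_intros lim_1_over_n | simp)+
      show "eventually (\<lambda>n. 1 - real j * (1 / real n) = real (n - j) / real n) sequentially"
        using eventually_gt_at_top[of j] by eventually_elim (simp add: field_simps)
    qed
  qed
  have bound: "norm (t j n) \<le> K * (\<bar>x\<bar> ^ j / fact j)" for j n
  proof -
    have "real (n - j) / real n \<le> 1" by (cases "n = 0") auto
    then have "\<bar>p (n - j)\<bar> * (\<bar>x\<bar> ^ j / fact j) * \<bar>real (n - j) / real n\<bar> \<le> K * (\<bar>x\<bar> ^ j / fact j) * 1"
      using K K0 by (intro mult_mono) auto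
    then show ?thesis by (simp add: t_def abs_mult power_abs)
  qed
  have "(\<lambda>n. suminf (\<lambda>j. t j n)) \<longlonglongrightarrow> suminf (\<lambda>j. L * (x ^ j / fact j) * 1)"
  proof (rule tannerys_theorem[where M = "\<lambda>j. K * (\<bar>x\<bar> ^ j / fact j)", THEN conjunct2, THEN conjunct2])
    show "eventually (\<lambda>(j, n). norm (t j n) \<le> K * (\<bar>x\<bar> ^ j / fact j)) (sequentially \<times>\<^sub>F sequentially)"
      by (rule always_eventually) (use bound in auto)
    show "summable (\<lambda>j. K * (\<bar>x\<bar> ^ j / fact j))"
      by (intro summable_mult sums_summable[OF exp_sums])
  qed (rule lim, simp)
  also have "suminf (\<lambda>j. L * (x ^ j / fact j) * 1) = L * exp x"
    using sums_mult[OF exp_sums[of x], of L] by (simp add: sums_iff)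
  finally have lim: "(\<lambda>n. suminf (\<lambda>j. t j n)) \<longlonglongrightarrow> L * exp x" .
  have "eventually (\<lambda>n. suminf (\<lambda>j. t j n)
      = (f oo (fps_X * inverse (1 - fps_const c * fps_X))) $ n / gfac a (n + 0)) sequentially"
    using eventually_ge_at_top[of 1]
  proof eventually_elim
    case (elim n)
    have "suminf (\<lambda>j. t j n) = (\<Sum>j<n. t j n)"
      by (rule suminf_finite) (auto simp: t_def)
    also have "\<dots> = (\<Sum>j<n. f $ (n - j) * (real ((n - 1) choose j) * c ^ j) / gfac a n)"
    proof (rule sum.cong)
      fix j assume j: "j \<in> {..<n}"
      have g: "gfac a (n - j) \<noteq> 0" "gfac a n \<noteq> 0" using gfac_nz[OF a] by auto
      have "real ((n - 1) choose j) = gfac a n * (real (n - j) / (real n * (a ^ j * fact j))) / gfac a (n - j)"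
        by (rule eq_divide_imp[OF g(1)]) (use gfac_diff_mult_choose[OF a, of j n] j in \<open>simp only: lessThan_iff mult.commute\<close>)
      then show "t j n = f $ (n - j) * (real ((n - 1) choose j) * c ^ j) / gfac a n"
        using g by (simp add: t_def p_def x_def power_divide mult_ac del: of_nat_diff)
    qed simp
    also have "\<dots> = (f oo (fps_X * inverse (1 - fps_const c * fps_X))) $ n / gfac a (n + 0)"
      using elim by (simp add: compose_moebius_nth sum_divide_distrib)
    finally show ?case .
  qed
  with lim show ?thesis unfolding fps_lim_def x_def by (simp add: Lim_transform_eventually)
qed

section \<open>Composition with a series that agrees with X up to second order\<close>

lemma fps_power_bound:
  fixes p :: "real fps"
  assumes a: "a > 0" and M: "M \<ge> 0" "\<And>m. \<bar>p $ m\<bar> \<le> M * gfac a (m + b)"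
  shows "\<bar>(p ^ l) $ r\<bar> \<le> (M * conv_const a b) ^ l * (1 / gfac a b) * gfac a (r + b)"
proof (induction l arbitrary: r)
  case 0
  then show ?case using gfac_pos[OF a, of "r + b"] gfac_pos[OF a, of b] by (cases "r = 0") auto
next
  case (Suc l)
  let ?K = "M * conv_const a b"
  have "\<bar>(p ^ Suc l) $ r\<bar> = \<bar>\<Sum>i=0..r - 0. p $ i * (p ^ l) $ (r - i)\<bar>"
    by (simp add: fps_mult_nth)
  \<comment> \<open>With cutoff 0 the full convolution stays on the same scale and offset; each
    multiplication by p costs only the constant \<open>?K\<close>. This geometric dependence on l is
    later beaten by 1 / l!.\<close>
  also have "\<dots> \<le> M * (?K ^ l * (1 / gfac a b)) * conv_const a (0 + b) * gfac a (r - 0 + b)"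
  proof (intro middle_bound a)
    fix i
    show "\<bar>p $ i\<bar> \<le> M * gfac a (i + b)" by (rule M)
    show "\<bar>(p ^ l) $ (r - i)\<bar> \<le> ?K ^ l * (1 / gfac a b) * gfac a (r - i + b)" by (rule Suc)
  qed (use M gfac_pos[OF a] conv_const_nonneg[OF a] in \<open>auto intro!: mult_nonneg_nonneg simp: less_imp_le\<close>)
  finally show ?case by (simp add: algebra_simps)
qed

text \<open>The binomial coefficient is traded for raising the factorial index by l, and the damping
  1 / l! remains available for the summation over l.\<close>

lemma choose_mult_gfac_le:
  assumes "a > 0"
  shows "real (k choose l) * gfac a (k + b) \<le> gfac a (k + l + b) / (a ^ l * fact l)"
proof -
  have "k choose l \<le> (k + l + b) choose l" by (rule binomial_right_mono) simp
  then have "real (k choose l) \<le> real ((k + l + b) choose l)" by simp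
  also have "\<dots> = fact (k + l + b) / (fact l * fact (k + b))"
    by (subst binomial_fact) (auto simp: algebra_simps)
  finally have "real (k choose l) * fact (k + b) \<le> fact (k + l + b) / fact l"
    by (simp add: field_simps)
  then have "a ^ (k + b) * (real (k choose l) * fact (k + b)) \<le> a ^ (k + b) * (fact (k + l + b) / fact l)"
    using assms by (intro mult_left_mono) auto
  then show ?thesis using assms by (simp add: gfac_def power_add field_simps)
qed

text \<open>Since \<open>Y = X (1 + X\<^sup>2 p)\<close>, every factor \<open>p\<close> in \<open>Y\<^sup>k = X\<^sup>k (1 + X\<^sup>2 p)\<^sup>k\<close> lowers the
  available degree by 2, while the binomial coefficient costs at most one power of \<open>k\<close>.\<close>

lemma compose_tangent_power_nth:
  fixes p :: "real fps"
  assumes "k < n"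
  shows "((fps_X * (1 + fps_X\<^sup>2 * p)) ^ k) $ n
    = (\<Sum>l=1..k. if k + 2 * l \<le> n then real (k choose l) * (p ^ l) $ (n - k - 2 * l) else 0)"
proof -
  have "(fps_X * (1 + fps_X\<^sup>2 * p)) ^ k = fps_X ^ k * (fps_X\<^sup>2 * p + 1) ^ k"
    by (simp add: power_mult_distrib add.commute)
  then have "((fps_X * (1 + fps_X\<^sup>2 * p)) ^ k) $ n = ((fps_X\<^sup>2 * p + 1) ^ k) $ (n - k)"
    using assms by (simp add: fps_X_power_mult_nth)
  also have "\<dots> = (\<Sum>l\<le>k. (of_nat (k choose l) * (fps_X\<^sup>2 * p) ^ l) $ (n - k))"
    by (simp only: binomial_ring power_one mult_1_right fps_sum_nth)
  also have "\<dots> = (\<Sum>l\<le>k. real (k choose l) * (if k + 2 * l \<le> n then (p ^ l) $ (n - k - 2 * l) else 0))"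
  proof (rule sum.cong)
    fix l
    have "(of_nat (k choose l) * (fps_X\<^sup>2 * p) ^ l) $ (n - k)
        = real (k choose l) * (fps_X ^ (2 * l) * p ^ l) $ (n - k)"
      by (simp only: fps_of_nat[symmetric] fps_mult_left_const_nth power_mult_distrib power_mult)
    also have "(fps_X ^ (2 * l) * p ^ l) $ (n - k) = (if k + 2 * l \<le> n then (p ^ l) $ (n - k - 2 * l) else 0)"
      using assms by (auto simp: fps_X_power_mult_nth)
    finally show "(of_nat (k choose l) * (fps_X\<^sup>2 * p) ^ l) $ (n - k)
      = real (k choose l) * (if k + 2 * l \<le> n then (p ^ l) $ (n - k - 2 * l) else 0)" .
  qed simp
  also have "\<dots> = (\<Sum>l=1..k. if k + 2 * l \<le> n then real (k choose l) * (p ^ l) $ (n - k - 2 * l) else 0)"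
  proof (rule sum.mono_neutral_cong_right)
    show "\<forall>l\<in>{..k} - {1..k}. real (k choose l) * (if k + 2 * l \<le> n then (p ^ l) $ (n - k - 2 * l) else 0) = 0"
      using assms by (auto simp: Suc_le_eq)
  qed auto
  finally show ?thesis .
qed

text \<open>In (s oo Y)_n the powers k = 1 and k = n yield s_1 Y_n and s_n; all powers in between
  lose one step of the factorial. The constant C is uniform in s, n and H, and only coefficients
  below n are assumed bounded, so that the estimate can feed an induction on n.\<close>

lemma compose_tangent_bound:
  fixes Y :: "real fps"
  assumes a: "a > 0" and Y: "Y $ 0 = 0" "Y $ 1 = 1" "Y $ 2 = 0" and bdd: "fps_bdd a b Y"
  shows "\<exists>C\<ge>0. \<forall>n\<ge>2. \<forall>s H. H \<ge> 0 \<longrightarrow> (\<forall>k<n. \<bar>s $ k\<bar> \<le> H * gfac a (k + b)) \<longrightarrow>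
     \<bar>(s oo Y) $ n - s $ n - s $ 1 * Y $ n\<bar> \<le> C * H * gfac a (n - 1 + b)"
proof -
  obtain M where M: "M \<ge> 0" "\<And>n. \<bar>Y $ n\<bar> \<le> M * gfac a (n + b)"
    using bdd unfolding fps_bdd_def by blast
  define p where "p = fps_shift 3 Y"
  define B where "B = b + 3"
  have cube: "fps_X * (1 + fps_X\<^sup>2 * p) = fps_X + fps_X ^ 3 * p"
    by (simp add: algebra_simps eval_nat_numeral)
  have Yp: "Y = fps_X * (1 + fps_X\<^sup>2 * p)"
    unfolding cube
  proof (rule fps_ext)
    fix n :: nat
    consider "n = 0" | "n = 1" | "n = 2" | m where "n = m + 3" by (metis One_nat_def Suc_1 add.commute
          less_Suc_eq less_one linorder_not_less not_less_eq numeral_3_eq_3 nat_le_iff_add)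
    then show "Y $ n = (fps_X + fps_X ^ 3 * p) $ n"
      by cases (use Y in \<open>auto simp: p_def fps_X_power_mult_nth\<close>)
  qed
  have p: "\<bar>p $ m\<bar> \<le> M * gfac a (m + B)" for m
    using M(2)[of "m + 3"] by (simp add: p_def B_def algebra_simps)
  define K where "K = M * conv_const a B"
  define c0 where "c0 = 1 / gfac a B"
  have K: "K \<ge> 0" and c0: "c0 \<ge> 0"
    using M conv_const_nonneg[OF a] gfac_pos[OF a, of B] by (auto simp: K_def c0_def)
  have pl: "\<bar>(p ^ l) $ r\<bar> \<le> K ^ l * c0 * gfac a (r + B)" for l r
    unfolding K_def c0_def by (rule fps_power_bound[OF a M(1) p])
  define C where "C = c0 * conv_const a B * a * exp (K / a\<^sup>2)"
  have C: "C \<ge> 0" using c0 conv_const_nonneg[OF a] a by (simp add: C_def)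
  have main: "\<bar>(s oo Y) $ n - s $ n - s $ 1 * Y $ n\<bar> \<le> C * H * gfac a (n - 1 + b)"
    if n: "n \<ge> 2" and H: "H \<ge> 0" and s: "\<And>k. k < n \<Longrightarrow> \<bar>s $ k\<bar> \<le> H * gfac a (k + b)" for n s H
  proof -
    let ?I = "\<lambda>l. {k \<in> {2..n-1}. l \<le> k \<and> k + 2 * l \<le> n}"
    let ?t = "\<lambda>k l. gfac a (k + l + b) * gfac a (n - k - 2 * l + B)"
    have "{0..n} = insert 0 (insert 1 (insert n {2..n-1}))" using n by auto
    then have "(s oo Y) $ n = s $ 1 * Y $ n + s $ n * (Y ^ n) $ n + (\<Sum>k=2..n-1. s $ k * (Y ^ k) $ n)"
      using n by (simp add: fps_compose_nth)
    moreover have "(Y ^ n) $ n = 1"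
      using startsby_zero_power_nth_same[OF Y(1), of n] Y(2) by simp
    ultimately have "\<bar>(s oo Y) $ n - s $ n - s $ 1 * Y $ n\<bar> = \<bar>\<Sum>k=2..n-1. s $ k * (Y ^ k) $ n\<bar>" by simp
    also have "\<dots> \<le> (\<Sum>k=2..n-1. \<bar>s $ k\<bar> * \<bar>(Y ^ k) $ n\<bar>)"
      by (rule order_trans[OF sum_abs]) (simp add: abs_mult)
    also have "\<dots> \<le> (\<Sum>k=2..n-1. \<Sum>l=1..k. if k + 2 * l \<le> n
        then H * c0 * ((K / a) ^ l / fact l) * ?t k l else 0)"
    proof (rule sum_mono)
      fix k assume k: "k \<in> {2..n-1}"
      then have kn: "k < n" using n by auto
      have "\<bar>(Y ^ k) $ n\<bar> \<le> (\<Sum>l=1..k. if k + 2 * l \<le> n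
          then real (k choose l) * (K ^ l * c0 * gfac a (n - k - 2 * l + B)) else 0)"
        unfolding Yp compose_tangent_power_nth[OF kn]
      proof (rule order_trans[OF sum_abs], rule sum_mono)
        fix l
        have "real (k choose l) * \<bar>(p ^ l) $ (n - k - 2 * l)\<bar>
            \<le> real (k choose l) * (K ^ l * c0 * gfac a (n - k - 2 * l + B))"
          by (intro mult_left_mono pl) simp
        then show "\<bar>if k + 2 * l \<le> n then real (k choose l) * (p ^ l) $ (n - k - 2 * l) else 0\<bar>
          \<le> (if k + 2 * l \<le> n then real (k choose l) * (K ^ l * c0 * gfac a (n - k - 2 * l + B)) else 0)"
          by (cases "k + 2 * l \<le> n") (simp_all only: if_True if_False abs_mult abs_of_nat abs_zero order_refl)
      qed
      then have "\<bar>s $ k\<bar> * \<bar>(Y ^ k) $ n\<bar> \<le> (H * gfac a (k + b)) * (\<Sum>l=1..k. if k + 2 * l \<le> n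
          then real (k choose l) * (K ^ l * c0 * gfac a (n - k - 2 * l + B)) else 0)"
        using s[OF kn] H gfac_pos[OF a, of "k + b"] by (intro mult_mono) auto
      also have "\<dots> = (\<Sum>l=1..k. if k + 2 * l \<le> n
          then H * c0 * K ^ l * gfac a (n - k - 2 * l + B) * (real (k choose l) * gfac a (k + b)) else 0)"
        unfolding sum_distrib_left by (intro sum.cong) (auto simp: algebra_simps)
      also have "\<dots> \<le> (\<Sum>l=1..k. if k + 2 * l \<le> n
          then H * c0 * K ^ l * gfac a (n - k - 2 * l + B) * (gfac a (k + l + b) / (a ^ l * fact l)) else 0)"
      proof (rule sum_mono)
        fix l
        have "H * c0 * K ^ l * gfac a (n - k - 2 * l + B) * (real (k choose l) * gfac a (k + b))
            \<le> H * c0 * K ^ l * gfac a (n - k - 2 * l + B) * (gfac a (k + l + b) / (a ^ l * fact l))"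
          using H c0 K gfac_pos[OF a, of "n - k - 2 * l + B"]
          by (intro mult_left_mono choose_mult_gfac_le a) auto
        then show "(if k + 2 * l \<le> n
            then H * c0 * K ^ l * gfac a (n - k - 2 * l + B) * (real (k choose l) * gfac a (k + b)) else 0)
          \<le> (if k + 2 * l \<le> n
            then H * c0 * K ^ l * gfac a (n - k - 2 * l + B) * (gfac a (k + l + b) / (a ^ l * fact l)) else 0)"
          by (simp only: if_split) auto
      qed
      also have "\<dots> = (\<Sum>l=1..k. if k + 2 * l \<le> n then H * c0 * ((K / a) ^ l / fact l) * ?t k l else 0)"
        by (intro sum.cong) (auto simp: power_divide field_simps)
      finally show "\<bar>s $ k\<bar> * \<bar>(Y ^ k) $ n\<bar> \<le> (\<Sum>l=1..k. if k + 2 * l \<le> n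
          then H * c0 * ((K / a) ^ l / fact l) * ?t k l else 0)" .
    qed
    also have "\<dots> = (\<Sum>k=2..n-1. \<Sum>l=1..n. if l \<le> k \<and> k + 2 * l \<le> n
        then H * c0 * ((K / a) ^ l / fact l) * ?t k l else 0)"
      by (intro sum.cong refl sum.mono_neutral_cong_left) auto
    also have "\<dots> = (\<Sum>l=1..n. \<Sum>k=2..n-1. if l \<le> k \<and> k + 2 * l \<le> n
        then H * c0 * ((K / a) ^ l / fact l) * ?t k l else 0)"
      by (rule sum.swap)
    also have "\<dots> = (\<Sum>l=1..n. H * c0 * ((K / a) ^ l / fact l) * (\<Sum>k\<in>?I l. ?t k l))"
    proof (rule sum.cong)
      fix l
      have "(\<Sum>k=2..n-1. if l \<le> k \<and> k + 2 * l \<le> n then H * c0 * ((K / a) ^ l / fact l) * ?t k l else 0)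
          = (\<Sum>k\<in>?I l. H * c0 * ((K / a) ^ l / fact l) * ?t k l)"
        by (intro sum.inter_filter[symmetric]) simp
      then show "(\<Sum>k=2..n-1. if l \<le> k \<and> k + 2 * l \<le> n then H * c0 * ((K / a) ^ l / fact l) * ?t k l else 0)
          = H * c0 * ((K / a) ^ l / fact l) * (\<Sum>k\<in>?I l. ?t k l)"
        by (simp only: sum_distrib_left)
    qed simp
    also have "\<dots> \<le> (\<Sum>l=1..n. H * c0 * ((K / a) ^ l / fact l) * (conv_const a B * (a / a ^ l * gfac a (n - 1 + b))))"
    proof (intro sum_mono mult_left_mono)
      fix l assume l: "l \<in> {1..n}"
      \<comment> \<open>The two factorial indices in \<open>?t\<close> add up to \<open>?N\<close>.
        Both are at least B = b + 3, the first because k >= 2 and l >= 1; the convolution bound with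
        cutoff B thus leaves n - l + b, which is at most n - 1 + b.\<close>
      let ?N = "n - l + 2 * b + 3"
      have "(\<Sum>k\<in>?I l. ?t k l) = (\<Sum>i\<in>(\<lambda>k. k + l + b) ` ?I l. gfac a i * gfac a (?N - i))"
        using l by (subst sum.reindex) (auto simp: inj_on_def B_def intro!: sum.cong arg_cong[of _ _ "gfac a"])
      also have "\<dots> \<le> (\<Sum>i=B..?N-B. gfac a i * gfac a (?N - i))"
        using l gfac_pos[OF a] by (intro sum_mono2) (auto simp: B_def less_imp_le)
      also have "\<dots> \<le> conv_const a B * gfac a (?N - B)" by (rule sum_gfac_mult_gfac_le[OF a])
      also have "?N - B = n - l + b" using l by (auto simp: B_def)
      also have "gfac a (n - l + b) \<le> a / a ^ l * gfac a (n - 1 + b)"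
      proof -
        have "a ^ (n - 1 + b) * a = a ^ (n - l + b) * a ^ l"
          using l n by (simp flip: power_add power_Suc2)
        then have "a ^ (n - l + b) = a / a ^ l * a ^ (n - 1 + b)" using a by (simp add: field_simps)
        moreover
        have "(fact (n - l + b) :: real) \<le> fact (n - 1 + b)" using l by (intro fact_mono) auto
        then have "(a / a ^ l * a ^ (n - 1 + b)) * fact (n - l + b) \<le> (a / a ^ l * a ^ (n - 1 + b)) * fact (n - 1 + b)"
          using a by (intro mult_left_mono) auto
        ultimately show ?thesis unfolding gfac_def by (simp only: mult.assoc)
      qed
      finally show "(\<Sum>k\<in>?I l. ?t k l) \<le> conv_const a B * (a / a ^ l * gfac a (n - 1 + b))"
        using conv_const_nonneg[OF a] by (simp add: mult_left_mono)
    qed (use H c0 K a in auto)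
    also have "\<dots> = H * c0 * conv_const a B * a * gfac a (n - 1 + b) * (\<Sum>l=1..n. (K / a\<^sup>2) ^ l / fact l)"
      unfolding sum_distrib_left using a
      by (intro sum.cong) (auto simp: power_divide field_simps power_mult[symmetric] power_add[symmetric] mult_2_right)
    also have "\<dots> \<le> H * c0 * conv_const a B * a * gfac a (n - 1 + b) * exp (K / a\<^sup>2)"
    proof (intro mult_left_mono)
      have s: "(\<lambda>j. (K / a\<^sup>2) ^ j / fact j) sums exp (K / a\<^sup>2)"
        using exp_converges[of "K / a\<^sup>2"] by (simp add: field_simps)
      have "sum (\<lambda>j. (K / a\<^sup>2) ^ j / fact j) {1..n} \<le> suminf (\<lambda>j. (K / a\<^sup>2) ^ j / fact j)"
        using K a by (intro sum_le_suminf sums_summable[OF s]) auto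
      then show "(\<Sum>l=1..n. (K / a\<^sup>2) ^ l / fact l) \<le> exp (K / a\<^sup>2)" using s by (simp add: sums_iff)
    qed (use H c0 a conv_const_nonneg[OF a] gfac_pos[OF a] in \<open>auto intro!: mult_nonneg_nonneg simp: less_imp_le\<close>)
    finally show ?thesis by (simp add: C_def mult_ac)
  qed
  show ?thesis using C main by blast
qed

text \<open>The deviation of (s oo Y)_n from s_n + s_1 Y_n is controlled by earlier coefficients of
  s with an extra 1/n, so the bootstrap yields the bound on s without inverting Y.\<close>

lemma fps_bdd_compose_tangent_imp_bdd:
  fixes Y s :: "real fps"
  assumes a: "a > 0" and Y: "Y $ 0 = 0" "Y $ 1 = 1" "Y $ 2 = 0" and bdd: "fps_bdd a b Y" "fps_bdd a b (s oo Y)"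
  shows "fps_bdd a b s"
proof -
  obtain C where C: "C \<ge> 0" "\<And>n s H. n \<ge> 2 \<Longrightarrow> H \<ge> 0 \<Longrightarrow> (\<And>k. k < n \<Longrightarrow> \<bar>s $ k\<bar> \<le> H * gfac a (k + b)) \<Longrightarrow>
     \<bar>(s oo Y) $ n - s $ n - s $ 1 * Y $ n\<bar> \<le> C * H * gfac a (n - 1 + b)"
    using compose_tangent_bound[OF a Y bdd(1)] by blast
  obtain M where M: "M \<ge> 0" "\<And>n. \<bar>Y $ n\<bar> \<le> M * gfac a (n + b)"
    using bdd(1) unfolding fps_bdd_def by blast
  obtain S where S: "S \<ge> 0" "\<And>n. \<bar>(s oo Y) $ n\<bar> \<le> S * gfac a (n + b)"
    using bdd(2) unfolding fps_bdd_def by blast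
  let ?g = "\<lambda>n. gfac a (n + b)"
  have g: "?g m > 0" for m using gfac_pos[OF a] .
  have "\<exists>H\<ge>0. \<forall>n. \<bar>s $ n\<bar> / ?g n \<le> H"
  proof (rule bootstrap_bound)
    fix n H assume n: "n \<ge> (2::nat)" and H: "H \<ge> (0::real)" and less: "\<And>m. m < n \<Longrightarrow> \<bar>s $ m\<bar> / ?g m \<le> H"
    have gn: "?g n = a * (real n + real b) * gfac a (n - 1 + b)"
      using n by (cases n) (auto simp: gfac_Suc algebra_simps)
    have "\<bar>(s oo Y) $ n - s $ n - s $ 1 * Y $ n\<bar> \<le> C * H * gfac a (n - 1 + b)"
      using less g by (intro C n H) (simp add: divide_le_eq)
    also have "\<dots> \<le> C * H * (?g n / (a * real n))"
      using a n gfac_pos[OF a, of "n - 1 + b"] C H unfolding gn by (intro mult_left_mono) (auto simp: field_simps)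
    finally have "\<bar>(s oo Y) $ n - s $ n - s $ 1 * Y $ n\<bar> \<le> C * H * (?g n / (a * real n))" .
    then have "\<bar>s $ n\<bar> \<le> \<bar>(s oo Y) $ n\<bar> + \<bar>s $ 1\<bar> * \<bar>Y $ n\<bar> + C * H * (?g n / (a * real n))"
      unfolding abs_mult[symmetric] by linarith
    also have "\<dots> \<le> S * ?g n + \<bar>s $ 1\<bar> * (M * ?g n) + C * H * (?g n / (a * real n))"
      using S M by (intro add_mono mult_left_mono order_refl) auto
    also have "\<dots> = ((S + \<bar>s $ 1\<bar> * M) + (C / a) * H / real n) * ?g n" by (simp add: field_simps)
    finally show "\<bar>s $ n\<bar> / ?g n \<le> (S + \<bar>s $ 1\<bar> * M) + (C / a) * H / real n"
      using g[of n] by (simp only: pos_divide_le_eq)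
  qed
  then obtain H where "H \<ge> 0" "\<And>n. \<bar>s $ n\<bar> / ?g n \<le> H" by blast
  then show ?thesis unfolding fps_bdd_def
    using gfac_pos[OF a] by (intro exI[of _ H]) (auto simp: divide_le_eq)
qed

lemma fps_lim_compose_tangent:
  fixes Y s :: "real fps"
  assumes a: "a > 0" and Y: "Y $ 0 = 0" "Y $ 1 = 1" "Y $ 2 = 0"
    and "fps_lim a b Y L" "fps_lim a b (s oo Y) M"
  shows "fps_lim a b s (M - s $ 1 * L)"
proof -
  have bY: "fps_bdd a b Y" using assms fps_lim_imp_bdd by blast
  have "fps_bdd a b (s oo Y)" using assms fps_lim_imp_bdd by blast
  then obtain H where H: "H \<ge> 0" "\<And>n. \<bar>s $ n\<bar> \<le> H * gfac a (n + b)"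
    using fps_bdd_compose_tangent_imp_bdd[OF a Y bY] unfolding fps_bdd_def by blast
  obtain C where C: "\<And>n. n \<ge> 2 \<Longrightarrow> \<bar>(s oo Y) $ n - s $ n - s $ 1 * Y $ n\<bar> \<le> C * H * gfac a (n - 1 + b)"
    using compose_tangent_bound[OF a Y bY] H by blast
  have "(\<lambda>n. ((s oo Y) $ n - s $ n - s $ 1 * Y $ n) / gfac a (n + b)) \<longlonglongrightarrow> 0"
    by (rule gfac_small_tendsto_0[OF a C])
  then have "(\<lambda>n. (s oo Y) $ n / gfac a (n + b) - s $ 1 * (Y $ n / gfac a (n + b))
      - ((s oo Y) $ n - s $ n - s $ 1 * Y $ n) / gfac a (n + b)) \<longlonglongrightarrow> M - s $ 1 * L - 0"
    using assms(5,6) unfolding fps_lim_def by (intro tendsto_diff tendsto_mult_left)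
  then show ?thesis by (simp add: fps_lim_def diff_divide_distrib)
qed

section \<open>The leading asymptotics of the renormalization constant\<close>

text \<open>The odd numbers up to 4k+1 are split by their residue modulo 4 into 1, 5, ..., 4k+1 and
  3, 7, ..., 4k-1.\<close>

lemma odd_dfact_pochhammer:
  "odd_dfact (2 * k + 1) = 4 * 16 ^ k * pochhammer (1 / 4) (k + 1) * pochhammer (3 / 4) k"
proof (induction k)
  case 0
  then show ?case by (simp add: odd_dfact_def)
next
  case (Suc k)
  have "odd_dfact (2 * Suc k + 1) = (4 * real k + 5) * (4 * real k + 3) * odd_dfact (2 * k + 1)"
    by (simp add: odd_dfact_Suc algebra_simps)
  also have "\<dots> = (4 * real k + 5) * (4 * real k + 3) * (4 * 16 ^ k * pochhammer (1 / 4) (k + 1) * pochhammer (3 / 4) k)"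
    by (simp only: Suc)
  also have "\<dots> = 4 * 16 ^ Suc k * (pochhammer (1 / 4) (k + 1) * (1 / 4 + real (k + 1)))
      * (pochhammer (3 / 4) k * (3 / 4 + real k))"
    by (simp add: field_simps)
  also have "\<dots> = 4 * 16 ^ Suc k * pochhammer (1 / 4) (Suc k + 1) * pochhammer (3 / 4) (Suc k)"
    by (simp add: pochhammer_Suc)
  finally show ?case .
qed

lemma rGamma_quarter_mult: "rGamma (1 / 4) * rGamma (3 / 4 :: real) = sqrt 2 / (2 * pi)"
proof -
  have "complex_of_real (rGamma (1 / 4) * rGamma (3 / 4)) = rGamma (1 / 4) * rGamma (1 - 1 / 4)"
    using rGamma_complex_of_real[of "1 / 4"] rGamma_complex_of_real[of "3 / 4"] by simp
  also have "\<dots> = sin (complex_of_real (pi / 4)) / complex_of_real pi"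
    by (subst rGamma_reflection_complex) simp
  also have "\<dots> = complex_of_real (sin (pi / 4) / pi)" by (simp only: sin_of_real[of "pi / 4"] of_real_divide[of "sin (pi / 4)" pi])
  finally show ?thesis by (simp only: of_real_eq_iff sin_45)
qed

text \<open>After division by the scale the coefficient is 4 (1/4)_(k+1) (3/4)_k / (k!)^2. These are
  two Gauss products for 1/Gamma; as 1/4 + 3/4 = 1, their powers of k multiply to k, which
  compensates the surplus factor 3/4 + k.\<close>

lemma phi4_P_1_lim: "fps_lim (2 / 3) 0 (phi4_P 1) (2 * sqrt 2 / pi)"
proof -
  have "(\<lambda>k. 4 * (rGamma_series (1 / 4) k * rGamma_series (3 / 4) k) * (1 / (1 + (3 / 4) * (1 / real k))))
      \<longlonglongrightarrow> 4 * (rGamma (1 / 4) * rGamma (3 / 4)) * (1 / (1 + (3 / 4) * 0))"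
    by (intro tendsto_intros rGamma_series_LIMSEQ lim_1_over_n) simp
  also have "4 * (rGamma (1 / 4) * rGamma (3 / 4 :: real)) * (1 / (1 + (3 / 4) * 0)) = 2 * sqrt 2 / pi"
    unfolding rGamma_quarter_mult by simp
  finally have lim: "(\<lambda>k. 4 * (rGamma_series (1 / 4) k * rGamma_series (3 / 4) k)
      * (1 / (1 + (3 / 4) * (1 / real k)))) \<longlonglongrightarrow> 2 * sqrt 2 / pi" .
  have "eventually (\<lambda>k. 4 * (rGamma_series (1 / 4) k * rGamma_series (3 / 4) k)
      * (1 / (1 + (3 / 4) * (1 / real k))) = phi4_P 1 $ k / gfac (2 / 3) (k + 0)) sequentially"
    using eventually_gt_at_top[of 0]
  proof eventually_elim
    case (elim k)
    define u v where "u = pochhammer (1 / 4 :: real) (k + 1)" and "v = pochhammer (3 / 4 :: real) k"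
    have e: "exp (1 / 4 * ln (real k)) * exp (3 / 4 * ln (real k)) = real k"
      using elim by (simp flip: exp_add)
    have "rGamma_series (1 / 4) k * rGamma_series (3 / 4) k
        = u * (v * (3 / 4 + real k)) / (fact k * fact k * (exp (1 / 4 * ln (real k)) * exp (3 / 4 * ln (real k))))"
      by (simp add: rGamma_series_def u_def v_def pochhammer_Suc mult_ac)
    also have "\<dots> = u * (v * (3 / 4 + real k)) / (fact k * fact k * real k)" by (simp only: e)
    finally have "4 * (rGamma_series (1 / 4) k * rGamma_series (3 / 4) k) * (1 / (1 + (3 / 4) * (1 / real k)))
        = 4 * (u * v) / (fact k * fact k)"
      using elim by (simp add: divide_simps) (simp add: algebra_simps)
    also have "\<dots> = (4 * 16 ^ k * u * v / (fact 4 ^ k * fact k)) / ((2 / 3) ^ k * fact k)"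
    proof -
      have "(fact 4 :: real) = 24" by (simp add: fact_numeral)
      moreover have "(24 :: real) ^ k * (2 / 3) ^ k = 16 ^ k" by (simp flip: power_mult_distrib)
      ultimately show ?thesis by (simp add: field_simps)
    qed
    also have "\<dots> = phi4_P 1 $ k / gfac (2 / 3) (k + 0)"
      using odd_dfact_pochhammer[of k] by (simp add: phi4_P_def gfac_def u_def v_def)
    finally show ?case .
  qed
  with lim show ?thesis unfolding fps_lim_def by (rule Lim_transform_eventually)
qed

lemma phi4_P_0_lim: "fps_lim (2 / 3) 0 (phi4_P 0) 0"
proof -
  have "(\<lambda>k. (phi4_P 1 $ k / gfac (2 / 3) (k + 0)) * (1 / (4 * real k + 1))) \<longlonglongrightarrow> (2 * sqrt 2 / pi) * 0"
    using phi4_P_1_lim unfolding fps_lim_def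
  proof (rule tendsto_mult)
    have "filterlim (\<lambda>k. 4 * real k + 1) at_top sequentially"
      by (intro filterlim_tendsto_add_at_top[OF tendsto_const, of _ _ 1, simplified add.commute[of 1]]
          filterlim_tendsto_pos_mult_at_top[OF tendsto_const] filterlim_real_sequentially) simp_all
    then show "(\<lambda>k. 1 / (4 * real k + 1)) \<longlonglongrightarrow> 0"
      using tendsto_inverse_0_at_top by (simp add: divide_inverse)
  qed
  moreover have "(phi4_P 1 $ k / gfac (2 / 3) (k + 0)) * (1 / (4 * real k + 1))
      = phi4_P 0 $ k / gfac (2 / 3) (k + 0)" for k
  proof -
    have "phi4_P 1 $ k = (4 * real k + 1) * phi4_P 0 $ k"
      by (simp add: phi4_P_def odd_dfact_Suc)
    moreover have "4 * real k + 1 \<noteq> 0" by linarith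
    ultimately show ?thesis by simp
  qed
  ultimately show ?thesis by (simp add: fps_lim_def)
qed

section \<open>Transfer of the leading behaviour from the explicit series to s\<close>

lemma phi4_F_P: "(phi4_F + 3) * fps_X * (phi4_P 1)\<^sup>2 = 6 * (phi4_P 1 - phi4_P 0) * phi4_P 0"
  using phi4_F_w unfolding phi4_w_P[symmetric] by algebra

lemma phi4_s_F_P: "(phi4_s oo phi4_F) * (phi4_P 0)\<^sup>2 = fps_X * (phi4_P 1)\<^sup>2"
  unfolding phi4_s_F phi4_w_P[symmetric] by (simp add: power_mult_distrib mult_ac)

text \<open>As \<open>\<alpha> = 1 + 5/2 \<hbar> + \<dots>\<close>, the substitution \<open>\<hbar> = t / (1 + 5/2 t)\<close> makes
  \<open>\<hbar>\<^sub>r\<^sub>e\<^sub>n\<close> equal to \<open>t + O(t\<^sup>3)\<close>; it is the source of the factor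
  \<open>exp (- (5/2) (3/2))\<close>.\<close>

lemma phi4_s_lim: "fps_lim (2 / 3) 1 phi4_s (- (12 * sqrt 2 / pi * exp (- 15 / 4)))"
proof -
  define c :: real where "c = - 5 / 2"
  define d where "d = 1 - fps_const c * fps_X"
  define m where "m = fps_X * inverse d"
  define q0 where "q0 = phi4_P 0 oo m"
  define q1 where "q1 = phi4_P 1 oo m"
  define Y where "Y = phi4_F oo m"
  define L where "L = 2 * sqrt 2 / pi * exp (- 15 / 4)"
  have a: "(2 / 3 :: real) > 0" by simp
  have m0: "m $ 0 = 0" by (simp add: m_def)
  have ec: "exp (c / (2 / 3)) = exp (- 15 / 4)" by (simp add: c_def)
  have q1: "fps_lim (2 / 3) 0 q1 L" and q0: "fps_lim (2 / 3) 0 q0 0"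
    using fps_lim_compose_moebius[OF a phi4_P_1_lim, of c] fps_lim_compose_moebius[OF a phi4_P_0_lim, of c]
    by (simp_all only: q1_def q0_def m_def d_def L_def ec mult_zero_left)
  have q1_0: "q1 $ 0 = 1" and q0_0: "q0 $ 0 = 1" using phi4_P_coeffs by (simp_all add: q1_def q0_def)
  have d0: "d $ 0 = 1" by (simp add: d_def)
  have inv: "q1 * inverse q1 = 1" "q0 * inverse q0 = 1" "d * inverse d = 1"
    by (simp_all add: inverse_mult_eq_1' q1_0 q0_0 d0)
  have d: "fps_lim (2 / 3) 0 d 0"
    unfolding d_def by (rule fps_lim_finite[of 2]) auto
  have Y0: "Y $ 0 = 0" by (simp add: Y_def phi4_F_0)
  have Y1: "Y $ 1 = 1" and Y2: "Y $ 2 = 0"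
    using compose_moebius_nth[of 1 phi4_F c] compose_moebius_nth[of 2 phi4_F c] phi4_F_1 phi4_F_2
    by (simp_all add: Y_def m_def d_def c_def lessThan_Suc numeral_2_eq_2)
  have F: "(Y + 3) * m * q1\<^sup>2 = 6 * (q1 - q0) * q0"
    using arg_cong[OF phi4_F_P, of "\<lambda>f. f oo m"] m0
    by (simp add: Y_def q0_def q1_def fps_compose_mult_distrib fps_compose_add_distrib
      fps_compose_sub_distrib fps_X_fps_compose_startby0 power2_eq_square numeral_fps_const)
  have "fps_X * (Y + 3) = 6 * d * (q1 - q0) * q0 * inverse q1 * inverse q1"
    using F inv unfolding m_def by algebra
  \<comment> \<open>The factor q1 - q0 has constant term 0, so by the product rule only its own
    leading coefficient L survives. Cancelling X afterwards raises the offset to 1.\<close>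
  moreover have "fps_lim (2 / 3) 0 (6 * d * (q1 - q0) * q0 * inverse q1 * inverse q1) (6 * L)"
    using fps_lim_mult[OF a fps_lim_mult[OF a fps_lim_mult[OF a fps_lim_mult[OF a fps_lim_mult[OF a
        fps_lim_numeral[of _ _ "num.Bit0 (num.Bit1 num.One)"] d] fps_lim_diff[OF q1 q0]] q0]
        fps_lim_inverse[OF a q1 q1_0]] fps_lim_inverse[OF a q1 q1_0]]
    by (simp add: q1_0 q0_0 d0)
  ultimately have "fps_lim (2 / 3) 1 (Y + 3) (6 * L)"
    using fps_lim_X_mult_cancel by fastforce
  then have Y: "fps_lim (2 / 3) 1 Y (6 * L)"
    using fps_lim_diff[OF _ fps_lim_numeral[of _ _ "num.Bit1 num.One"]] by fastforce
  have sm: "(phi4_s oo phi4_F) oo m = phi4_s oo Y"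
    unfolding Y_def by (rule fps_compose_assoc[symmetric]) (use m0 phi4_F_0 in auto)
  have "(phi4_s oo Y) * q0\<^sup>2 = m * q1\<^sup>2"
    using arg_cong[OF phi4_s_F_P, of "\<lambda>f. f oo m"] m0
    by (simp add: sm q0_def q1_def fps_compose_mult_distrib fps_X_fps_compose_startby0 power2_eq_square)
  then have "phi4_s oo Y = fps_X * inverse d * q1 * q1 * inverse q0 * inverse q0"
    using inv unfolding m_def by algebra
  \<comment> \<open>No division by X occurs here: the series has offset 0, one step of the factorial
    below Y, and hence limit 0 at offset 1.\<close>
  moreover obtain M where "fps_lim (2 / 3) 0 (fps_X * inverse d * q1 * q1 * inverse q0 * inverse q0) M"
    using fps_lim_mult[OF a fps_lim_mult[OF a fps_lim_mult[OF a fps_lim_mult[OF a fps_lim_mult[OF a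
        fps_lim_X fps_lim_inverse[OF a d d0]] q1] q1]
        fps_lim_inverse[OF a q0 q0_0]] fps_lim_inverse[OF a q0 q0_0]] by blast
  ultimately have "fps_lim (2 / 3) 1 (phi4_s oo Y) 0"
    using fps_lim_raise[OF a] by fastforce
  then have "fps_lim (2 / 3) 1 phi4_s (0 - phi4_s $ 1 * (6 * L))"
    by (rule fps_lim_compose_tangent[OF a Y0 Y1 Y2 Y])
  moreover have "0 - phi4_s $ 1 * (6 * L) = - (12 * sqrt 2 / pi * exp (- 15 / 4))"
    unfolding phi4_s_1 by (simp add: L_def)
  ultimately show ?thesis by (simp only:)
qed

section \<open>Asymptotic expansions in the factorial scale\<close>

text \<open>The base index n + 1 matches the offset 1 found for s, and each further k lowers the
  factorial by one. Truncation of the subtraction concerns finitely many n only.\<close>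

definition fscale :: "real \<Rightarrow> nat \<Rightarrow> nat \<Rightarrow> real" where
  "fscale a k n = gfac a (n + 1 - k)"

definition has_expansion :: "real \<Rightarrow> (nat \<Rightarrow> real) \<Rightarrow> (nat \<Rightarrow> real) \<Rightarrow> nat \<Rightarrow> bool" where
  "has_expansion a f d R \<longleftrightarrow> (\<lambda>n. f n - (\<Sum>k<R. d k * fscale a k n)) \<in> O(fscale a R)"

lemma fscale_pos: "a > 0 \<Longrightarrow> fscale a k n > 0"
  by (simp add: fscale_def gfac_pos)

lemma fscale_step:
  assumes "n \<ge> k"
  shows "fscale a k n = a * (real n + 1 - real k) * fscale a (Suc k) n"
proof -
  have "n + 1 - k = Suc (n - k)" using assms by simp
  then show ?thesis using assms by (simp add: fscale_def gfac_Suc)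
qed

lemma fscale_shift: "n \<ge> j \<Longrightarrow> fscale a k (n - j) = fscale a (k + j) n"
  by (simp add: fscale_def add_ac)

lemma mult_fscale_bigo:
  assumes a: "a > 0"
  shows "(\<lambda>n. real n * fscale a (Suc k) n) \<in> O(fscale a k)"
proof (rule bigoI[of _ "2 / a"])
  show "\<forall>\<^sub>F n in sequentially. norm (real n * fscale a (Suc k) n) \<le> 2 / a * norm (fscale a k n)"
    using eventually_ge_at_top[of "2 * k"]
  proof eventually_elim
    case (elim n)
    have "real n * fscale a (Suc k) n \<le> (2 * (real n + 1 - real k)) * fscale a (Suc k) n"
      using elim fscale_pos[OF a, of "Suc k" n] by (intro mult_right_mono) auto
    also have "\<dots> = 2 / a * fscale a k n"
      using elim a by (simp add: fscale_step[of k n])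
    finally show ?case
      using fscale_pos[OF a] by (simp add: abs_mult less_imp_le)
  qed
qed

lemma fscale_Suc_smallo:
  assumes a: "a > 0"
  shows "fscale a (Suc k) \<in> o(fscale a k)"
proof (rule smalloI_tendsto)
  show "eventually (\<lambda>n. fscale a k n \<noteq> 0) sequentially"
    using fscale_pos[OF a] by (simp add: less_imp_neq[symmetric])
  have "(\<lambda>n. gfac a (n - 1) / gfac a n) \<longlonglongrightarrow> 0"
    using gfac_ratio_tendsto_0[OF a, of 0] by simp
  moreover have "filterlim (\<lambda>n. n + 1 - k) sequentially sequentially"
    using filterlim_compose[OF filterlim_minus_const_nat_at_top filterlim_Suc] by simp
  ultimately have "(\<lambda>n. gfac a (n + 1 - k - 1) / gfac a (n + 1 - k)) \<longlonglongrightarrow> 0"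
    by (rule filterlim_compose)
  then show "(\<lambda>n. fscale a (Suc k) n / fscale a k n) \<longlonglongrightarrow> 0"
    by (simp add: fscale_def)
qed

lemma fscale_bigo_mono:
  assumes a: "a > 0" and "k \<le> j"
  shows "fscale a j \<in> O(fscale a k)"
  using assms(2)
proof (induction j rule: dec_induct)
  case (step j)
  then show ?case using landau_o.small_imp_big[OF fscale_Suc_smallo[OF a]] landau_o.big_trans by blast
qed simp

lemma bigo_fscale_shift:
  assumes "f \<in> O(fscale a k)"
  shows "(\<lambda>n. f (n - j)) \<in> O(fscale a (k + j))"
proof -
  have "(\<lambda>n. f (n - j)) \<in> O(\<lambda>n. fscale a k (n - j))"
    by (rule landau_o.big.compose[OF assms filterlim_minus_const_nat_at_top])
  also have "\<dots> = O(fscale a (k + j))"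
    by (intro landau_o.big.cong eventually_mono[OF eventually_ge_at_top[of j]]) (rule fscale_shift)
  finally show ?thesis .
qed

lemma bigo_fscale_mult_n:
  assumes a: "a > 0" and "f \<in> O(fscale a (Suc k))"
  shows "(\<lambda>n. real n * f n) \<in> O(fscale a k)"
  using landau_o.big.mult_left[OF assms(2), of "\<lambda>n. real n"] mult_fscale_bigo[OF a]
  by (rule landau_o.big_trans)

lemma has_expansion_cong:
  assumes "eventually (\<lambda>n. f n = h n) sequentially" "\<And>k. k < R \<Longrightarrow> d k = e k"
  shows "has_expansion a f d R \<longleftrightarrow> has_expansion a h e R"
  unfolding has_expansion_def
proof (rule landau_o.big.in_cong)
  show "\<forall>\<^sub>F n in sequentially. f n - (\<Sum>k<R. d k * fscale a k n) = h n - (\<Sum>k<R. e k * fscale a k n)"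
    using assms(1) by eventually_elim (simp add: assms(2))
qed

lemma has_expansion_mono:
  assumes a: "a > 0" and f: "has_expansion a f d R" and "r \<le> R"
  shows "has_expansion a f d r"
proof -
  have "(\<lambda>n. \<Sum>k\<in>{r..<R}. d k * fscale a k n) \<in> O(fscale a r)"
    by (intro big_sum_in_bigo landau_o.big.mult_in_1 | simp add: fscale_bigo_mono[OF a])+
  moreover have "(\<lambda>n. f n - (\<Sum>k<R. d k * fscale a k n)) \<in> O(fscale a r)"
    using f fscale_bigo_mono[OF a \<open>r \<le> R\<close>] unfolding has_expansion_def by (rule landau_o.big_trans)
  ultimately have "(\<lambda>n. (f n - (\<Sum>k<R. d k * fscale a k n)) + (\<Sum>k\<in>{r..<R}. d k * fscale a k n)) \<in> O(fscale a r)"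
    by (rule sum_in_bigo(1)[rotated])
  moreover have "(\<Sum>k<R. d k * fscale a k n) = (\<Sum>k<r. d k * fscale a k n) + (\<Sum>k\<in>{r..<R}. d k * fscale a k n)" for n
    unfolding lessThan_atLeast0 using \<open>r \<le> R\<close> by (intro sum.atLeastLessThan_concat[symmetric]) auto
  then have "(f n - (\<Sum>k<R. d k * fscale a k n)) + (\<Sum>k\<in>{r..<R}. d k * fscale a k n)
      = f n - (\<Sum>k<r. d k * fscale a k n)" for n
    by simp
  ultimately show ?thesis unfolding has_expansion_def by (simp only:)
qed

lemma has_expansion_zero: "f \<in> O(fscale a R) \<Longrightarrow> has_expansion a f (\<lambda>_. 0) R"
  by (simp add: has_expansion_def)

lemma has_expansion_add:
  assumes "has_expansion a f d R" "has_expansion a h e R"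
  shows "has_expansion a (\<lambda>n. f n + h n) (\<lambda>k. d k + e k) R"
  using sum_in_bigo(1)[OF assms[unfolded has_expansion_def]]
  by (simp add: has_expansion_def sum.distrib algebra_simps)

lemma has_expansion_cmult:
  assumes "has_expansion a f d R"
  shows "has_expansion a (\<lambda>n. c * f n) (\<lambda>k. c * d k) R"
proof -
  have "(\<lambda>n. c * (f n - (\<Sum>k<R. d k * fscale a k n))) \<in> O(fscale a R)"
    using assms unfolding has_expansion_def by (cases "c = 0") auto
  then show ?thesis by (simp add: has_expansion_def sum_distrib_left algebra_simps)
qed

lemma has_expansion_sum:
  assumes "\<And>i. i \<in> I \<Longrightarrow> has_expansion a (f i) (d i) R"
  shows "has_expansion a (\<lambda>n. \<Sum>i\<in>I. f i n) (\<lambda>k. \<Sum>i\<in>I. d i k) R"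
  using assms
proof (induction I rule: infinite_finite_induct)
  case (insert i I)
  then show ?case using has_expansion_add[of a "f i" "d i" R] by simp
qed (auto intro: has_expansion_zero)

lemma has_expansion_shift:
  assumes "has_expansion a f d R"
  shows "has_expansion a (\<lambda>n. f (n - j)) (\<lambda>k. if k < j then 0 else d (k - j)) (R + j)"
proof -
  have "(\<lambda>n. f (n - j) - (\<Sum>k<R. d k * fscale a k (n - j))) \<in> O(fscale a (R + j))"
    using assms unfolding has_expansion_def by (rule bigo_fscale_shift)
  moreover have "eventually (\<lambda>n. f (n - j) - (\<Sum>k<R. d k * fscale a k (n - j))
      = f (n - j) - (\<Sum>k<R + j. (if k < j then 0 else d (k - j)) * fscale a k n)) sequentially"
    using eventually_ge_at_top[of j]
  proof eventually_elim
    case (elim n)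
    have "(\<Sum>k<R. d k * fscale a k (n - j)) = (\<Sum>k<R. d k * fscale a (k + j) n)"
      by (simp add: fscale_shift[OF elim])
    also have "\<dots> = (\<Sum>k\<in>{j..<R + j}. d (k - j) * fscale a k n)"
      by (rule sum.reindex_bij_witness[of _ "\<lambda>k. k - j" "\<lambda>k. k + j"]) auto
    also have "\<dots> = (\<Sum>k<R + j. (if k < j then 0 else d (k - j)) * fscale a k n)"
      by (rule sum.mono_neutral_cong_left) auto
    finally show ?case by simp
  qed
  ultimately show ?thesis
    unfolding has_expansion_def by (rule landau_o.big.in_cong[THEN iffD1, rotated])
qed

text \<open>The scale satisfies n fscale_(k+1) = fscale_k / a + (k - 1) fscale_(k+1) exactly for n
  >= k, so multiplication by n moves every coefficient down one place and adds a multiple of it at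
  its old place. The condition on \<open>d 0\<close> prevents the result from leaving the
  scale.\<close>

lemma has_expansion_mult_n:
  assumes a: "a > 0" and f: "has_expansion a f d (Suc R)" and d0: "d 0 = 0"
  shows "has_expansion a (\<lambda>n. real n * f n) (\<lambda>k. d (k + 1) / a + (real k - 2) * d k) R"
proof -
  let ?e = "\<lambda>k. d (k + 1) / a + (real k - 2) * d k"
  have "(\<lambda>n. real n * (f n - (\<Sum>k<Suc R. d k * fscale a k n))) \<in> O(fscale a R)"
    using f unfolding has_expansion_def by (rule bigo_fscale_mult_n[OF a])
  moreover have "(\<lambda>n. (real R - 2) * d R * fscale a R n) \<in> O(fscale a R)"
    by simp
  ultimately have "(\<lambda>n. real n * (f n - (\<Sum>k<Suc R. d k * fscale a k n)) + (real R - 2) * d R * fscale a R n) \<in> O(fscale a R)"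
    by (rule sum_in_bigo)
  moreover have "eventually (\<lambda>n. real n * (f n - (\<Sum>k<Suc R. d k * fscale a k n)) + (real R - 2) * d R * fscale a R n
      = real n * f n - (\<Sum>k<R. ?e k * fscale a k n)) sequentially"
    using eventually_ge_at_top[of R]
  proof eventually_elim
    case (elim n)
    have n: "real n * fscale a (Suc k) n = fscale a k n / a + (real k - 1) * fscale a (Suc k) n" if "k < R" for k
    proof -
      have "fscale a k n / a = (real n + 1 - real k) * fscale a (Suc k) n"
        using that elim a by (simp add: fscale_step[of k n])
      then show ?thesis by (simp add: algebra_simps)
    qed
    have "real n * (\<Sum>k<Suc R. d k * fscale a k n) = (\<Sum>k<R. d (Suc k) * (real n * fscale a (Suc k) n))"
      by (subst sum.lessThan_Suc_shift) (simp add: d0 sum_distrib_left mult_ac)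
    also have "\<dots> = (\<Sum>k<R. d (Suc k) / a * fscale a k n + (real (Suc k) - 2) * d (Suc k) * fscale a (Suc k) n)"
      by (intro sum.cong) (auto simp: n algebra_simps)
    also have "\<dots> = (\<Sum>k<R. d (Suc k) / a * fscale a k n) + (\<Sum>k<R. (real (Suc k) - 2) * d (Suc k) * fscale a (Suc k) n)"
      by (rule sum.distrib)
    also have "(\<Sum>k<R. (real (Suc k) - 2) * d (Suc k) * fscale a (Suc k) n) = (\<Sum>k<Suc R. (real k - 2) * d k * fscale a k n)"
      by (subst sum.lessThan_Suc_shift) (simp add: d0)
    also have "(\<Sum>k<R. d (Suc k) / a * fscale a k n) + \<dots>
        = (\<Sum>k<R. ?e k * fscale a k n) + (real R - 2) * d R * fscale a R n"
      by (simp add: sum.distrib distrib_right)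
    finally show ?case by (simp add: algebra_simps)
  qed
  ultimately show ?thesis
    unfolding has_expansion_def by (rule landau_o.big.in_cong[THEN iffD1, rotated])
qed

lemma has_expansion_unique:
  assumes a: "a > 0" and f: "has_expansion a f d R" "has_expansion a f e R" and "k < R"
  shows "d k = e k"
  using \<open>k < R\<close>
proof (induction k rule: less_induct)
  case (less k)
  have "has_expansion a f d (Suc k)" "has_expansion a f e (Suc k)"
    using f less.prems has_expansion_mono[OF a] by (auto simp: Suc_le_eq)
  then have "(\<lambda>n. (f n - (\<Sum>i<Suc k. e i * fscale a i n)) - (f n - (\<Sum>i<Suc k. d i * fscale a i n))) \<in> O(fscale a (Suc k))"
    unfolding has_expansion_def by (rule sum_in_bigo(2)[rotated])
  moreover have "(\<Sum>i<k. d i * fscale a i n) = (\<Sum>i<k. e i * fscale a i n)" for n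
    using less by (intro sum.cong) auto
  ultimately have "(\<lambda>n. (d k - e k) * fscale a k n) \<in> O(fscale a (Suc k))" by (simp add: algebra_simps)
  then have "(\<lambda>n. (d k - e k) * fscale a k n) \<in> o(fscale a k)"
    using fscale_Suc_smallo[OF a] by (rule landau_o.big_small_trans)
  then have "(\<lambda>n. ((d k - e k) * fscale a k n) / fscale a k n) \<longlonglongrightarrow> 0"
    by (rule smalloD_tendsto)
  moreover have "((d k - e k) * fscale a k n) / fscale a k n = d k - e k" for n
    using fscale_pos[OF a, of k n] by simp
  ultimately show ?case by (simp add: LIMSEQ_const_iff)
qed

section \<open>Existence of expansions and first-order difference equations\<close>

definition expandable :: "real \<Rightarrow> nat \<Rightarrow> nat \<Rightarrow> (nat \<Rightarrow> real) \<Rightarrow> bool" where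
  "expandable a m R f \<longleftrightarrow> (\<exists>d. has_expansion a f d R \<and> (\<forall>k<m. d k = 0))"

lemma expandable_mono:
  "a > 0 \<Longrightarrow> expandable a m R f \<Longrightarrow> r \<le> R \<Longrightarrow> p \<le> m \<Longrightarrow> expandable a p r f"
  unfolding expandable_def using has_expansion_mono by (meson order_less_le_trans)

lemma expandable_bigo: "f \<in> O(fscale a R) \<Longrightarrow> expandable a m R f"
  unfolding expandable_def using has_expansion_zero by blast

lemma expandable_add:
  "expandable a m R f \<Longrightarrow> expandable a m R h \<Longrightarrow> expandable a m R (\<lambda>n. f n + h n)"
  unfolding expandable_def using has_expansion_add by force

lemma expandable_cmult: "expandable a m R f \<Longrightarrow> expandable a m R (\<lambda>n. c * f n)"
  unfolding expandable_def using has_expansion_cmult by force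

lemma expandable_sum:
  assumes "\<And>i. i \<in> I \<Longrightarrow> expandable a m R (f i)"
  shows "expandable a m R (\<lambda>n. \<Sum>i\<in>I. f i n)"
  using assms
proof (induction I rule: infinite_finite_induct)
  case (insert i I)
  then show ?case using expandable_add[of a m R "f i"] by simp
qed (auto intro: expandable_bigo)

lemma expandable_shift:
  assumes "expandable a m R f"
  shows "expandable a (m + j) (R + j) (\<lambda>n. f (n - j))"
proof -
  obtain d where d: "has_expansion a f d R" "\<And>k. k < m \<Longrightarrow> d k = 0"
    using assms unfolding expandable_def by blast
  have "\<forall>k<m + j. (if k < j then 0 else d (k - j)) = 0" using d(2) by auto
  with has_expansion_shift[OF d(1), of j] show ?thesis
    unfolding expandable_def by (intro exI[of _ "\<lambda>k. if k < j then 0 else d (k - j)"] conjI)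
qed

lemma expandable_cong:
  assumes "eventually (\<lambda>n. f n = h n) sequentially"
  shows "expandable a m R f \<longleftrightarrow> expandable a m R h"
  unfolding expandable_def using has_expansion_cong[OF assms, of R] by simp

text \<open>The recurrence is solved by comparing \<open>x n / fscale a 0 n\<close> with \<open>fscale a r n / fscale a 0 n\<close>,
  whose increments are known exactly.\<close>

lemma bigo_fscale_summation:
  assumes a: "a > 0" and r: "r \<ge> 1"
    and lim: "(\<lambda>n. x n / fscale a 0 n) \<longlonglongrightarrow> 0"
    and step: "(\<lambda>n. x n - a * (real n + 1) * x (n - 1)) \<in> O(fscale a (Suc r))"
  shows "x \<in> O(fscale a r)"
proof -
  obtain K where K: "K > 0" "eventually (\<lambda>n. norm (x n - a * (real n + 1) * x (n - 1)) \<le> K * norm (fscale a (Suc r) n)) sequentially"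
    using step by (elim landau_o.bigE)
  then obtain N0 where N0: "\<And>n. n \<ge> N0 \<Longrightarrow> \<bar>x n - a * (real n + 1) * x (n - 1)\<bar> \<le> K * fscale a (Suc r) n"
    using fscale_pos[OF a] unfolding eventually_sequentially by (metis abs_of_pos real_norm_def)
  define N where "N = max N0 (r + 1)"
  \<comment> \<open>With this choice the error bound K fscale_r(n) / fscale_0(n+1) is exactly C
    times the decrement of \<open>\<phi>\<close>; this is where r >= 1 enters.\<close>
  define C where "C = K / (a * real r)"
  have aK: "K = C * a * real r" using a r by (simp add: C_def)
  define \<theta> where "\<theta> = (\<lambda>n. x n / fscale a 0 n)"
  define \<phi> where "\<phi> = (\<lambda>n. fscale a r n / fscale a 0 n)"
  have step': "\<bar>\<theta> (Suc n) - \<theta> n\<bar> \<le> C * (\<phi> n - \<phi> (Suc n))" if "n \<ge> N" for n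
  proof -
    have n: "Suc n \<ge> N0" "Suc n \<ge> r" "Suc n \<ge> 1" using that by (auto simp: N_def)
    have s0: "fscale a 0 (Suc n) = a * (real (Suc n) + 1) * fscale a 0 n"
      by (simp add: fscale_def gfac_Suc)
    have s1: "fscale a (Suc r) (Suc n) = fscale a r n"
      using fscale_shift[of 1 "Suc n" a r] by simp
    have sr: "fscale a r (Suc n) = a * (real (Suc n) + 1 - real r) * fscale a r n"
      using fscale_step[OF n(2), of a] s1 by simp
    have p: "fscale a 0 (Suc n) > 0" "fscale a 0 n > 0" by (rule fscale_pos[OF a])+
    have q: "a * (real (Suc n) + 1) > 0" using a by simp
    have "\<theta> (Suc n) - \<theta> n = (x (Suc n) - a * (real (Suc n) + 1) * x n) / fscale a 0 (Suc n)"
      unfolding \<theta>_def diff_divide_distrib s0 using q a by simp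
    also have "\<bar>\<dots>\<bar> \<le> K * fscale a r n / fscale a 0 (Suc n)"
      using N0[OF n(1)] p by (simp add: abs_divide divide_right_mono s1)
    also have "\<dots> = C * ((a * (real (Suc n) + 1) * fscale a r n - fscale a r (Suc n)) / fscale a 0 (Suc n))"
      unfolding sr aK by (simp add: algebra_simps)
    also have "(a * (real (Suc n) + 1) * fscale a r n - fscale a r (Suc n)) / fscale a 0 (Suc n) = \<phi> n - \<phi> (Suc n)"
      unfolding \<phi>_def diff_divide_distrib by (subst (1) s0) (use q a in simp)
    finally show ?thesis .
  qed
  have \<phi>: "\<phi> \<longlonglongrightarrow> 0"
  proof -
    have "fscale a r \<in> o(fscale a 0)"
    proof -
      have "fscale a r \<in> O(fscale a (Suc 0))" using r by (intro fscale_bigo_mono a) auto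
      then show ?thesis using fscale_Suc_smallo[OF a] by (rule landau_o.big_small_trans)
    qed
    then show ?thesis unfolding \<phi>_def by (rule smalloD_tendsto)
  qed
  have tail: "(\<lambda>n. y (n + N)) \<longlonglongrightarrow> 0" if "y \<longlonglongrightarrow> 0" for y :: "nat \<Rightarrow> real"
    using that by (rule LIMSEQ_ignore_initial_segment)
  have \<theta>: "\<theta> \<longlonglongrightarrow> 0" using lim by (simp add: \<theta>_def)
  \<comment> \<open>The increments of \<open>\<theta>\<close> are dominated by those of
    \<open>C * \<phi>\<close>, so \<open>\<theta> + C * \<phi>\<close> decreases and
    \<open>\<theta> - C * \<phi>\<close> increases; both tend to 0, which fixes their signs.\<close>
  have up: "\<theta> n + C * \<phi> n \<ge> 0" if "n \<ge> N" for n
  proof -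
    have "decseq (\<lambda>i. \<theta> (i + N) + C * \<phi> (i + N))"
    proof (rule decseq_SucI)
      fix i show "\<theta> (Suc i + N) + C * \<phi> (Suc i + N) \<le> \<theta> (i + N) + C * \<phi> (i + N)"
        using step'[of "i + N"] by (simp add: algebra_simps)
    qed
    moreover have "(\<lambda>i. \<theta> (i + N) + C * \<phi> (i + N)) \<longlonglongrightarrow> 0"
      using tendsto_add[OF tail[OF \<theta>] tendsto_mult_right_zero[OF tail[OF \<phi>], of C]] by simp
    ultimately have "0 \<le> \<theta> ((n - N) + N) + C * \<phi> ((n - N) + N)" by (rule decseq_ge)
    then show ?thesis using that by simp
  qed
  have low: "\<theta> n - C * \<phi> n \<le> 0" if "n \<ge> N" for n
  proof -
    have "incseq (\<lambda>i. \<theta> (i + N) - C * \<phi> (i + N))"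
    proof (rule incseq_SucI)
      fix i show "\<theta> (i + N) - C * \<phi> (i + N) \<le> \<theta> (Suc i + N) - C * \<phi> (Suc i + N)"
        using step'[of "i + N"] by (simp add: algebra_simps)
    qed
    moreover have "(\<lambda>i. \<theta> (i + N) - C * \<phi> (i + N)) \<longlonglongrightarrow> 0"
      using tendsto_diff[OF tail[OF \<theta>] tendsto_mult_right_zero[OF tail[OF \<phi>], of C]] by simp
    ultimately have "\<theta> ((n - N) + N) - C * \<phi> ((n - N) + N) \<le> 0" by (rule incseq_le)
    then show ?thesis using that by simp
  qed
  show ?thesis
  proof (rule bigoI[of _ C])
    show "\<forall>\<^sub>F n in sequentially. norm (x n) \<le> C * norm (fscale a r n)"
      using eventually_ge_at_top[of N]
    proof eventually_elim
      case (elim n)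
      have "\<bar>\<theta> n\<bar> \<le> C * \<phi> n" using up[OF elim] low[OF elim] by (simp add: abs_le_iff)
      then show ?case using fscale_pos[OF a, of 0 n] fscale_pos[OF a, of r n]
        by (simp add: \<theta>_def \<phi>_def abs_divide divide_le_cancel)
    qed
  qed
qed

text \<open>The difference operator maps fscale_k to - a k fscale_(k+1). Its image starts at index 2
  once k >= 1, hence the two vanishing coefficients; it annihilates fscale_0, so that coefficient
  must be supplied by the limit D.\<close>

lemma expandable_summation:
  assumes a: "a > 0" and lim: "(\<lambda>n. s n / fscale a 0 n) \<longlonglongrightarrow> D"
    and u: "expandable a 2 (R + 2) (\<lambda>n. s n - a * (real n + 1) * s (n - 1))"
  shows "expandable a 0 (R + 1) s"
proof -
  obtain e where e: "has_expansion a (\<lambda>n. s n - a * (real n + 1) * s (n - 1)) e (R + 2)" "e 0 = 0" "e 1 = 0"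
    using u unfolding expandable_def by auto
  define d where "d = (\<lambda>k. if k = 0 then D else - e (k + 1) / (a * real k))"
  define x where "x = (\<lambda>n. s n - (\<Sum>k<R + 1. d k * fscale a k n))"
  have d: "d k * (a * real k) = - e (k + 1)" for k
    using e(3) a by (auto simp: d_def)
  have "x \<in> O(fscale a (R + 1))"
  proof (rule bigo_fscale_summation[OF a])
    have "(\<lambda>n. s n / fscale a 0 n - (\<Sum>k<R + 1. d k * (fscale a k n / fscale a 0 n)))
        \<longlonglongrightarrow> D - (\<Sum>k<R + 1. d k * (if k = 0 then 1 else 0))"
    proof (intro tendsto_diff lim tendsto_sum tendsto_mult_left)
      fix k
      show "(\<lambda>n. fscale a k n / fscale a 0 n) \<longlonglongrightarrow> (if k = 0 then 1 else 0)"
      proof (cases "k = 0")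
        case True
        then show ?thesis using fscale_pos[OF a, of 0] by (simp add: less_imp_neq[symmetric])
      next
        case False
        then have "fscale a k \<in> O(fscale a (Suc 0))" by (intro fscale_bigo_mono a) auto
        then have "fscale a k \<in> o(fscale a 0)" using fscale_Suc_smallo[OF a] by (rule landau_o.big_small_trans)
        then show ?thesis using False by (auto dest: smalloD_tendsto)
      qed
    qed
    also have "D - (\<Sum>k<R + 1. d k * (if k = 0 then 1 else 0)) = 0"
      by (simp add: if_distrib[of "\<lambda>x. _ * x"] d_def cong: if_cong)
    finally show "(\<lambda>n. x n / fscale a 0 n) \<longlonglongrightarrow> 0"
      by (simp add: x_def diff_divide_distrib sum_divide_distrib del: sum.lessThan_Suc)
    have "eventually (\<lambda>n. x n - a * (real n + 1) * x (n - 1)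
        = (s n - a * (real n + 1) * s (n - 1)) - (\<Sum>k<R + 2. e k * fscale a k n)) sequentially"
      using eventually_ge_at_top[of "R + 1"]
    proof eventually_elim
      case (elim n)
      have sh: "fscale a k (n - 1) = fscale a (Suc k) n" for k using elim fscale_shift[of 1 n a k] by simp
      have "d k * fscale a k n - a * (real n + 1) * (d k * fscale a k (n - 1)) = e (Suc k) * fscale a (Suc k) n"
        if "k < R + 1" for k
      proof -
        have "d k * fscale a k n - a * (real n + 1) * (d k * fscale a k (n - 1))
            = - (d k * (a * real k)) * fscale a (Suc k) n"
        proof -
          have "fscale a k n = a * (real n + 1 - real k) * fscale a (Suc k) n"
            using that elim by (intro fscale_step) auto
          then show ?thesis unfolding sh by (simp only:) (simp add: algebra_simps)
        qed
        then show ?thesis unfolding d by simp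
      qed
      then have "(\<Sum>k<R + 1. d k * fscale a k n) - a * (real n + 1) * (\<Sum>k<R + 1. d k * fscale a k (n - 1))
          = (\<Sum>k<R + 1. e (Suc k) * fscale a (Suc k) n)"
        by (simp only: sum_distrib_left sum_subtractf[symmetric]) (intro sum.cong, auto)
      also have "\<dots> = (\<Sum>k<R + 2. e k * fscale a k n)"
        using sum.lessThan_Suc_shift[of "\<lambda>k. e k * fscale a k n" "R + 1"] e(2) by simp
      finally show ?case unfolding x_def by (simp only: right_diff_distrib)
    qed
    then show "(\<lambda>n. x n - a * (real n + 1) * x (n - 1)) \<in> O(fscale a (Suc (R + 1)))"
      using e(1) unfolding has_expansion_def by (simp add: landau_o.big.in_cong[THEN iffD2])
  qed simp
  then show ?thesis unfolding expandable_def has_expansion_def x_def by blast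
qed

section \<open>The expansion of the renormalization constant\<close>

text \<open>In half of the recurrence for s, the factor multiplying s_(n-j) is n times
  \<open>lin_A j\<close> plus \<open>lin_B j\<close>; the three summands stem from the squares at n
  + 1, n and n - 1.\<close>

definition lin_A :: "nat \<Rightarrow> real" where
  "lin_A j = 6 * phi4_s $ (j + 1) + 5 * phi4_s $ j + phi4_s $ (j - 1)"

definition lin_B :: "nat \<Rightarrow> real" where
  "lin_B j = 6 * phi4_s $ (j + 1) + 8 * phi4_s $ j + 3 * phi4_s $ (j - 1)"

lemma phi4_s_bdd: "fps_bdd (2 / 3) 1 phi4_s"
  using fps_lim_imp_bdd[OF _ phi4_s_lim] by simp

lemma fps_square_nth_split:
  fixes f :: "real fps"
  assumes "n \<ge> 2 * I + 1" and f0: "f $ 0 = 0"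
  shows "(f\<^sup>2) $ n = 2 * (\<Sum>i=1..I. f $ i * f $ (n - i)) + (\<Sum>i=I+1..n-(I+1). f $ i * f $ (n - i))"
proof -
  let ?g = "\<lambda>i. f $ i * f $ (n - i)"
  have eq: "{0..n} = {0, n} \<union> ({1..I} \<union> {n-I..n-1}) \<union> {I+1..n-(I+1)}" using assms by auto
  have "(f\<^sup>2) $ n = sum ?g {0..n}" by (simp add: power2_eq_square fps_mult_nth)
  also have "\<dots> = sum ?g {0, n} + (sum ?g {1..I} + sum ?g {n-I..n-1}) + sum ?g {I+1..n-(I+1)}"
    unfolding eq using assms by (subst sum.union_disjoint; (auto; fail)?)+
  also have "sum ?g {n-I..n-1} = sum ?g {1..I}"
    using assms by (intro sum.reindex_bij_witness[of _ "\<lambda>i. n - i" "\<lambda>i. n - i"]) auto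
  also have "sum ?g {0, n} = 0" using assms by simp
  finally show ?thesis by simp
qed

text \<open>Isolating the terms of \<open>s\<^sup>2\<close> in which one factor has index at most \<open>J\<close> turns the quadratic
  recurrence into a linear one.\<close>

lemma phi4_s_linear_recurrence:
  assumes J: "J \<ge> 1"
  shows "(\<lambda>n. 6 * phi4_s $ n + (\<Sum>j=1..J. (lin_A j * real n + lin_B j) * phi4_s $ (n - j))) \<in> O(fscale (2 / 3) J)"
proof -
  let ?s = "\<lambda>n. phi4_s $ n" and ?a = "2 / 3 :: real"
  obtain K where K: "K \<ge> 0" "\<And>n. \<bar>?s n\<bar> \<le> K * gfac ?a (n + 1)"
    using phi4_s_bdd unfolding fps_bdd_def by blast
  define mid where "mid = (\<lambda>I n. \<Sum>i=I+1..n-(I+1). ?s i * ?s (n - i))"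
  have mid: "\<exists>C\<ge>0. \<forall>n. \<bar>mid I n\<bar> \<le> C * gfac ?a (n - (I + 1) + 1)" for I
  proof (intro exI conjI allI)
    show "\<bar>mid I n\<bar> \<le> K * K * conv_const ?a (I + 1 + 1) * gfac ?a (n - (I + 1) + 1)" for n
      unfolding mid_def using K by (intro middle_bound) auto
    show "0 \<le> K * K * conv_const ?a (I + 1 + 1)"
      using K conv_const_nonneg[of ?a] by simp
  qed
  obtain C1 where C1: "C1 \<ge> 0" "\<And>n. \<bar>mid (J + 1) n\<bar> \<le> C1 * gfac ?a (n - (J + 2) + 1)"
    using mid[of "J + 1"] by auto
  obtain C2 where C2: "C2 \<ge> 0" "\<And>n. \<bar>mid J n\<bar> \<le> C2 * gfac ?a (n - (J + 1) + 1)"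
    using mid[of J] by auto
  obtain C3 where C3: "C3 \<ge> 0" "\<And>n. \<bar>mid (J - 1) n\<bar> \<le> C3 * gfac ?a (n - J + 1)"
    using mid[of "J - 1"] J by auto
  \<comment> \<open>The cutoffs J + 1, J, J - 1 for the squares at n + 1, n, n - 1 put all three
    remainders on the same scale of index J + 1; the factor n then costs one index.\<close>
  define err where "err = (\<lambda>n. 3 * (real n + 1) * mid (J + 1) (n + 1)
    + (5 / 2 * real n + 4) * mid J n + (real n + 3) / 2 * mid (J - 1) (n - 1))"
  have big: "(\<lambda>n. real n * fscale ?a (J + 1) n) \<in> O(fscale ?a J)"
    using mult_fscale_bigo[of ?a J] by simp
  have "err \<in> O(\<lambda>n. real n * fscale ?a (J + 1) n)"
  proof (rule bigoI[of _ "6 * C1 + 13 / 2 * C2 + 2 * C3"])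
    show "\<forall>\<^sub>F n in sequentially. norm (err n) \<le> (6 * C1 + 13 / 2 * C2 + 2 * C3) * norm (real n * fscale ?a (J + 1) n)"
      using eventually_ge_at_top[of "J + 2"]
    proof eventually_elim
      case (elim n)
      let ?g = "fscale ?a (J + 1) n"
      have g: "?g > 0" by (rule fscale_pos) simp
      have eqs: "n + 1 - (J + 2) + 1 = n + 1 - (J + 1)" "n - (J + 1) + 1 = n + 1 - (J + 1)"
        "n - 1 - J + 1 = n + 1 - (J + 1)"
        using elim by auto
      have m1: "\<bar>mid (J + 1) (n + 1)\<bar> \<le> C1 * ?g" and m2: "\<bar>mid J n\<bar> \<le> C2 * ?g"
        and m3: "\<bar>mid (J - 1) (n - 1)\<bar> \<le> C3 * ?g"
        using C1(2)[of "n + 1"] C2(2)[of n] C3(2)[of "n - 1"] unfolding eqs fscale_def by auto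
      have n1: "real n \<ge> 1" "real n \<ge> 3" using elim J by auto
      have "\<bar>err n\<bar> \<le> 3 * (real n + 1) * \<bar>mid (J + 1) (n + 1)\<bar>
          + (5 / 2 * real n + 4) * \<bar>mid J n\<bar> + (real n + 3) / 2 * \<bar>mid (J - 1) (n - 1)\<bar>"
      proof -
        have "\<bar>x + y + z\<bar> \<le> \<bar>x\<bar> + \<bar>y\<bar> + \<bar>z\<bar>" for x y z :: real by linarith
        from this[of "3 * (real n + 1) * mid (J + 1) (n + 1)" "(5 / 2 * real n + 4) * mid J n"
          "(real n + 3) / 2 * mid (J - 1) (n - 1)"]
        show ?thesis unfolding err_def abs_mult by simp
      qed
      also have "\<dots> \<le> (6 * real n) * (C1 * ?g) + (13 / 2 * real n) * (C2 * ?g) + (2 * real n) * (C3 * ?g)"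
        by (rule add_mono[OF add_mono[OF mult_mono[OF _ m1] mult_mono[OF _ m2]] mult_mono[OF _ m3]]) (use n1 in auto)
      finally show ?case using g by (simp add: algebra_simps abs_mult)
    qed
  qed
  then have err: "err \<in> O(fscale ?a J)" using big by (rule landau_o.big_trans)
  have "eventually (\<lambda>n. 6 * ?s n + (\<Sum>j=1..J. (lin_A j * real n + lin_B j) * ?s (n - j)) = - err n) sequentially"
    using eventually_ge_at_top[of "2 * J + 3"]
  proof eventually_elim
    case (elim n)
    have s01: "?s 0 = 0" "?s 1 = 1" using phi4_s_0 phi4_s_1 by auto
    define S1 where "S1 = (\<Sum>j=1..J. ?s (j + 1) * ?s (n - j))"
    define S2 where "S2 = (\<Sum>j=1..J. ?s j * ?s (n - j))"
    define S3 where "S3 = (\<Sum>j=1..J. ?s (j - 1) * ?s (n - j))"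
    have q1: "(phi4_s\<^sup>2) $ (n + 1) = 2 * (?s n + S1) + mid (J + 1) (n + 1)"
    proof -
      have "(phi4_s\<^sup>2) $ (n + 1) = 2 * (\<Sum>i=1..J+1. ?s i * ?s (n + 1 - i)) + mid (J + 1) (n + 1)"
        unfolding mid_def by (rule fps_square_nth_split) (use elim s01 in auto)
      also have "(\<Sum>i=1..J+1. ?s i * ?s (n + 1 - i)) = ?s 1 * ?s n + (\<Sum>i=Suc 1..Suc J. ?s i * ?s (n + 1 - i))"
        by (simp add: sum.atLeast_Suc_atMost)
      also have "(\<Sum>i=Suc 1..Suc J. ?s i * ?s (n + 1 - i)) = S1"
        unfolding S1_def sum.shift_bounds_cl_Suc_ivl by simp
      finally show ?thesis using s01 by simp
    qed
    have q2: "(phi4_s\<^sup>2) $ n = 2 * S2 + mid J n"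
      unfolding mid_def S2_def by (rule fps_square_nth_split) (use elim s01 in auto)
    have q3: "(phi4_s\<^sup>2) $ (n - 1) = 2 * S3 + mid (J - 1) (n - 1)"
    proof -
      have "(phi4_s\<^sup>2) $ (n - 1) = 2 * (\<Sum>i=1..J-1. ?s i * ?s (n - 1 - i)) + mid (J - 1) (n - 1)"
        unfolding mid_def by (rule fps_square_nth_split) (use elim s01 in auto)
      also have "(\<Sum>i=1..J-1. ?s i * ?s (n - 1 - i)) = (\<Sum>i=0..J-1. ?s i * ?s (n - 1 - i))"
        using s01 by (simp add: sum.atLeast_Suc_atMost[of 0])
      also have "\<dots> = S3"
        unfolding S3_def using J
        by (intro sum.reindex_bij_witness[of _ "\<lambda>i. i - 1" "\<lambda>i. i + 1"]) auto
      finally show ?thesis .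
    qed
    have "(\<Sum>j=1..J. (lin_A j * real n + lin_B j) * ?s (n - j))
        = (\<Sum>j=1..J. 6 * (real n + 1) * (?s (j + 1) * ?s (n - j)) + (5 * real n + 8) * (?s j * ?s (n - j))
            + (real n + 3) * (?s (j - 1) * ?s (n - j)))"
      by (intro sum.cong) (auto simp: lin_A_def lin_B_def algebra_simps)
    also have "\<dots> = 6 * (real n + 1) * S1 + (5 * real n + 8) * S2 + (real n + 3) * S3"
      by (simp only: sum.distrib sum_distrib_left[symmetric] S1_def S2_def S3_def)
    finally have lin: "(\<Sum>j=1..J. (lin_A j * real n + lin_B j) * ?s (n - j))
      = 6 * (real n + 1) * S1 + (5 * real n + 8) * S2 + (real n + 3) * S3" .
    \<comment> \<open>The term s_1 s_n of the first square gives 12 (n+1) s_n against 12 n s_n on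
      the left; after halving, 6 s_n is left over.\<close>
    have "12 * real n * ?s n = 6 * (real n + 1) * (2 * (?s n + S1) + mid (J + 1) (n + 1))
      + (5 * real n + 8) * (2 * S2 + mid J n) + (real n + 3) * (2 * S3 + mid (J - 1) (n - 1))"
      unfolding q1[symmetric] q2[symmetric] q3[symmetric] by (rule phi4_s_rec) (use elim in auto)
    then show ?case unfolding lin err_def by (simp add: field_simps)
  qed
  then show ?thesis
    by (rule landau_o.big.in_cong[THEN iffD2]) (use err in simp)
qed

text \<open>The difference operator that annihilates the leading growth (2/3)^(n+1) (n+1)!.\<close>

definition phi4_u :: "nat \<Rightarrow> real" where
  "phi4_u n = phi4_s $ n - 2 / 3 * (real n + 1) * phi4_s $ (n - 1)"

lemma lin_AB_coeffs:
  "lin_A 1 = - 4" "lin_A 2 = - 2" "lin_A 3 = - 6" "lin_A 4 = - 23" "lin_A 5 = - 109"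
  "lin_B 1 = - 1" "lin_B 2 = - 9 / 2" "lin_B 3 = - 27 / 4" "lin_B 4 = - 205 / 8" "lin_B 5 = - 1923 / 16"
  by (simp_all add: lin_A_def lin_B_def phi4_s_coeffs phi4_s_0 phi4_s_1 phi4_s_1[unfolded One_nat_def]
        del: One_nat_def)

text \<open>By the linear recurrence \<open>6 u\<^sub>n + 3 u\<^sub>n\<^sub>-\<^sub>1\<close> involves only \<open>s\<^sub>n\<^sub>-\<^sub>i\<close> and \<open>u\<^sub>n\<^sub>-\<^sub>i\<close> with \<open>i \<ge> 2\<close>,
  the terms \<open>n s\<^sub>n\<^sub>-\<^sub>j\<close> with \<open>j \<ge> 3\<close> being eliminated by means of \<open>u\<^sub>n\<^sub>-\<^sub>j\<^sub>+\<^sub>1\<close>.\<close>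

lemma phi4_u_expandable_step:
  assumes s: "expandable (2 / 3) 0 R (\<lambda>n. phi4_s $ n)" and u: "expandable (2 / 3) 2 r phi4_u"
    and r: "r \<le> R + 1"
  shows "expandable (2 / 3) 2 (r + 1) phi4_u"
proof -
  let ?s = "\<lambda>n. phi4_s $ n" and ?a = "2 / 3 :: real"
  let ?J = "R + 2"
  have a: "?a > 0" by simp
  define E where "E = (\<lambda>n. 6 * ?s n + (\<Sum>j=1..?J. (lin_A j * real n + lin_B j) * ?s (n - j)))"
  have E: "expandable ?a 2 (r + 1) E"
  proof (rule expandable_bigo)
    have "E \<in> O(fscale ?a ?J)" unfolding E_def by (rule phi4_s_linear_recurrence) simp
    also have "fscale ?a ?J \<in> O(fscale ?a (r + 1))" using r by (intro fscale_bigo_mono a) auto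
    finally show "E \<in> O(fscale ?a (r + 1))" .
  qed
  define T where "T = (\<lambda>j n. (lin_A j * real n + lin_B j) * ?s (n - j))"
  have T: "expandable ?a 2 (r + 1) (T j)" if j: "j \<in> {3..?J}" for j
  proof -
    have "eventually (\<lambda>n. 3 / 2 * lin_A j * ?s (n - (j - 1)) + (- (3 / 2 * lin_A j)) * phi4_u (n - (j - 1))
        + (lin_A j * (real j - 2) + lin_B j) * ?s (n - j) = T j n) sequentially"
      using eventually_ge_at_top[of j]
    proof eventually_elim
      case (elim n)
      have n: "n - (j - 1) - 1 = n - j" "real (n - (j - 1)) = real n - real j + 1" using elim j by auto
      show ?case unfolding phi4_u_def T_def n by (simp add: field_simps)
    qed
    moreover have "expandable ?a 2 (r + 1) (\<lambda>n. 3 / 2 * lin_A j * ?s (n - (j - 1))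
        + (- (3 / 2 * lin_A j)) * phi4_u (n - (j - 1)) + (lin_A j * (real j - 2) + lin_B j) * ?s (n - j))"
      using j r
      by (intro expandable_add expandable_cmult expandable_mono[OF a expandable_shift[OF s]]
          expandable_mono[OF a expandable_shift[OF u]]) auto
    ultimately show ?thesis by (rule expandable_cong[THEN iffD1])
  qed
  \<comment> \<open>Because \<open>lin_A 2\<close> is -2, the terms -3 s_(n-1) + 2 n s_(n-2) left
    beside 6 u_n are exactly -3 u_(n-1). This cancellation removes s_(n-1), which would give u a
    nonzero coefficient at index 1 and obstruct the summation.\<close>
  have "eventually (\<lambda>n. - (1 / 2) * phi4_u (n - 1) + 3 / 4 * ?s (n - 2) + (- 1 / 6) * (\<Sum>j=3..?J. T j n) + 1 / 6 * E n
      = phi4_u n) sequentially"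
    using eventually_ge_at_top[of 2]
  proof eventually_elim
    case (elim n)
    have n: "n - 1 - 1 = n - 2" "real (n - 1) = real n - 1" using elim by auto
    have "(\<Sum>j=1..?J. T j n) = T 1 n + (T 2 n + (\<Sum>j=3..?J. T j n))"
      using sum.atLeast_Suc_atMost[of 1 ?J "\<lambda>j. T j n"] sum.atLeast_Suc_atMost[of 2 ?J "\<lambda>j. T j n"]
      by (simp add: eval_nat_numeral del: sum.cl_ivl_Suc)
    then have "E n = 6 * ?s n + T 1 n + T 2 n + (\<Sum>j=3..?J. T j n)"
      by (simp add: E_def T_def)
    moreover have "T 1 n = (- 4 * real n - 1) * ?s (n - 1)" "T 2 n = (- 2 * real n - 9 / 2) * ?s (n - 2)"
      using lin_AB_coeffs by (simp_all add: T_def)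
    moreover have "phi4_u n = ?s n - 2 / 3 * (real n + 1) * ?s (n - 1)" by (rule phi4_u_def)
    moreover have "phi4_u (n - 1) = ?s (n - 1) - 2 / 3 * real n * ?s (n - 2)"
      unfolding phi4_u_def n by simp
    ultimately show ?case by (simp add: field_simps)
  qed
  moreover have "expandable ?a 2 (r + 1)
      (\<lambda>n. - (1 / 2) * phi4_u (n - 1) + 3 / 4 * ?s (n - 2) + (- 1 / 6) * (\<Sum>j=3..?J. T j n) + 1 / 6 * E n)"
    using r
    by (intro expandable_add expandable_cmult expandable_sum E T expandable_mono[OF a expandable_shift[OF s]]
        expandable_mono[OF a expandable_shift[OF u]]) auto
  ultimately show ?thesis by (rule expandable_cong[THEN iffD1])
qed

section \<open>The full expansion of s\<close>

lemma phi4_s_ratio_lim: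
  "(\<lambda>n. phi4_s $ n / fscale (2 / 3) 0 n) \<longlonglongrightarrow> - (12 * sqrt 2 / pi * exp (- 15 / 4))"
  using phi4_s_lim by (simp add: fps_lim_def fscale_def)

lemma phi4_s_bigo: "(\<lambda>n. phi4_s $ n) \<in> O(fscale (2 / 3) 0)"
proof -
  obtain K where K: "\<And>n. \<bar>phi4_s $ n\<bar> \<le> K * gfac (2 / 3) (n + 1)"
    using phi4_s_bdd unfolding fps_bdd_def by blast
  show ?thesis
    using K gfac_pos[of "2 / 3"]
    by (intro bigoI[of _ K] always_eventually) (auto simp: fscale_def abs_of_pos)
qed

text \<open>Two nested inductions: with s known to order R, the order of u improves one at a time up
  to R + 2, since u is fed by delayed values of itself and of s; summation then gives s to order R +
  1.\<close>

lemma phi4_s_expandable: "expandable (2 / 3) 0 R (\<lambda>n. phi4_s $ n)"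
proof (induction R)
  case 0
  show ?case by (rule expandable_bigo) (rule phi4_s_bigo)
next
  case (Suc R)
  have a: "(2 / 3 :: real) > 0" by simp
  have "expandable (2 / 3) 2 r phi4_u" if "r \<le> R + 2" for r
    using that
  proof (induction r)
    case 0
    have "(\<lambda>n. phi4_s $ (n - 1)) \<in> O(fscale (2 / 3) (0 + 1))"
      by (rule bigo_fscale_shift[OF phi4_s_bigo])
    then have 1: "(\<lambda>n. phi4_s $ (n - 1)) \<in> O(fscale (2 / 3) (Suc 0))" by simp
    have 2: "(\<lambda>n. real n * phi4_s $ (n - 1)) \<in> O(fscale (2 / 3) 0)"
      by (rule bigo_fscale_mult_n[OF a 1])
    have 3: "(\<lambda>n. phi4_s $ (n - 1)) \<in> O(fscale (2 / 3) 0)"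
      using 1 fscale_bigo_mono[OF a, of 0 "Suc 0"] landau_o.big_trans by blast
    have "(\<lambda>n. phi4_s $ n - (2 / 3 * (real n * phi4_s $ (n - 1)) + 2 / 3 * phi4_s $ (n - 1))) \<in> O(fscale (2 / 3) 0)"
      using phi4_s_bigo 2 3 by (intro sum_in_bigo) auto
    also have "(\<lambda>n. phi4_s $ n - (2 / 3 * (real n * phi4_s $ (n - 1)) + 2 / 3 * phi4_s $ (n - 1))) = phi4_u"
      by (rule ext) (simp add: phi4_u_def field_simps)
    finally have "phi4_u \<in> O(fscale (2 / 3) 0)" .
    then show ?case by (rule expandable_bigo)
  next
    case (Suc r)
    then show ?case using phi4_u_expandable_step[OF \<open>expandable (2 / 3) 0 R _\<close>, of r] by simp
  qed
  then have "expandable (2 / 3) 2 (R + 2) phi4_u" by simp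
  then show ?case
    using expandable_summation[OF a phi4_s_ratio_lim, of R] by (simp add: phi4_u_def[abs_def])
qed

lemma phi4_s_expansion:
  "\<exists>d. (\<forall>R. has_expansion (2 / 3) (\<lambda>n. phi4_s $ n) d R) \<and> d 0 = - (12 * sqrt 2 / pi * exp (- 15 / 4))"
proof -
  have a: "(2 / 3 :: real) > 0" by simp
  obtain D where D: "\<And>R. has_expansion (2 / 3) (\<lambda>n. phi4_s $ n) (D R) R"
    using phi4_s_expandable unfolding expandable_def by metis
  \<comment> \<open>Each order R comes with its own coefficients; uniqueness makes them agree below
    R, so the diagonal serves all R at once.\<close>
  define d where "d = (\<lambda>k. D (Suc k) k)"
  have d: "has_expansion (2 / 3) (\<lambda>n. phi4_s $ n) d R" for R
  proof -
    have eq: "D R k = d k" if "k < R" for k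
      unfolding d_def using that
      by (intro has_expansion_unique[OF a has_expansion_mono[OF a D] D]) auto
    show ?thesis by (rule has_expansion_cong[THEN iffD1, OF _ _ D[of R]]) (simp_all add: eq)
  qed
  have "(\<lambda>n. phi4_s $ n - d 0 * fscale (2 / 3) 0 n) \<in> O(fscale (2 / 3) (Suc 0))"
    using d[of "Suc 0"] by (simp add: has_expansion_def)
  then have "(\<lambda>n. phi4_s $ n - d 0 * fscale (2 / 3) 0 n) \<in> o(fscale (2 / 3) 0)"
    using fscale_Suc_smallo[OF a] by (rule landau_o.big_small_trans)
  then have "(\<lambda>n. (phi4_s $ n - d 0 * fscale (2 / 3) 0 n) / fscale (2 / 3) 0 n) \<longlonglongrightarrow> 0"
    by (rule smalloD_tendsto)
  moreover have "(phi4_s $ n - d 0 * fscale (2 / 3) 0 n) / fscale (2 / 3) 0 n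
      = phi4_s $ n / fscale (2 / 3) 0 n - d 0" for n
    using fscale_pos[OF a, of 0 n] by (simp add: diff_divide_distrib)
  ultimately have "(\<lambda>n. phi4_s $ n / fscale (2 / 3) 0 n - d 0) \<longlonglongrightarrow> 0" by simp
  then have "(\<lambda>n. phi4_s $ n / fscale (2 / 3) 0 n) \<longlonglongrightarrow> d 0" by (rule LIM_zero_cancel)
  with phi4_s_ratio_lim have "d 0 = - (12 * sqrt 2 / pi * exp (- 15 / 4))"
    using LIMSEQ_unique by blast
  with d show ?thesis by blast
qed

text \<open>Inserting the expansion into the linear recurrence, \<open>lin_A 1\<close> = -4 cancels
  6 d_k at order k, and d_(k-1) appears with factor -4 (k-1). Order 1 therefore leaves d_0 free,
  while orders 2, 3, 4 determine d_1, d_2, d_3; at order 4 the delays reach j = 5.\<close>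

lemma phi4_s_expansion_coeffs:
  assumes d: "\<And>R. has_expansion (2 / 3) (\<lambda>n. phi4_s $ n) d R"
  shows "d 1 = - 27 / 8 * d 0" "d 2 = 81 / 128 * d 0" "d 3 = - 5673 / 1024 * d 0"
proof -
  let ?s = "\<lambda>n. phi4_s $ n" and ?a = "2 / 3 :: real"
  have a: "?a > 0" by simp
  define sh where "sh = (\<lambda>j k. if k < j then 0 else d (k - j))"
  define e where "e = (\<lambda>k. 6 * d k + (\<Sum>j=1..5. lin_A j * (sh j (k + 1) / ?a + (real k - 2) * sh j k) + lin_B j * sh j k))"
  have "has_expansion ?a (\<lambda>n. 6 * ?s n + (\<Sum>j=1..5. lin_A j * (real n * ?s (n - j)) + lin_B j * ?s (n - j))) e 5"
    unfolding e_def
  proof (intro has_expansion_add has_expansion_cmult has_expansion_sum d)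
    fix j :: nat assume j: "j \<in> {1..5}"
    have sh: "has_expansion ?a (\<lambda>n. ?s (n - j)) (sh j) 6"
      unfolding sh_def by (rule has_expansion_mono[OF a has_expansion_shift[OF d[of 6]]]) simp
    then show "has_expansion ?a (\<lambda>n. ?s (n - j)) (sh j) 5" by (rule has_expansion_mono[OF a]) simp
    show "has_expansion ?a (\<lambda>n. real n * ?s (n - j)) (\<lambda>k. sh j (k + 1) / ?a + (real k - 2) * sh j k) 5"
      using sh j by (intro has_expansion_mult_n a) (auto simp: sh_def eval_nat_numeral)
  qed
  moreover have "has_expansion ?a (\<lambda>n. 6 * ?s n + (\<Sum>j=1..5. lin_A j * (real n * ?s (n - j)) + lin_B j * ?s (n - j))) (\<lambda>_. 0) 5"
    using phi4_s_linear_recurrence[of 5] by (intro has_expansion_zero) (simp add: algebra_simps)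
  ultimately have e: "e k = 0" if "k < 5" for k
    using has_expansion_unique[OF a] that by blast
  have sum5: "(\<Sum>j=1..5. f j) = f 1 + f 2 + f 3 + f 4 + f 5" for f :: "nat \<Rightarrow> real"
    by (simp add: eval_nat_numeral)
  have "e 2 = 0" "e 3 = 0" "e 4 = 0" using e by auto
  then show "d 1 = - 27 / 8 * d 0" "d 2 = 81 / 128 * d 0" "d 3 = - 5673 / 1024 * d 0"
    unfolding e_def sum5 lin_AB_coeffs by (simp_all add: sh_def)
qed

section \<open>Translation into Gamma functions and the final statement\<close>

lemma Gamma_descending:
  assumes "k \<le> n"
  shows "Gamma (real n + 3) = Gamma (real n + 3 - real k) * (\<Prod>i=1..k. real n + 3 - real i)"
  using assms
proof (induction k)
  case (Suc k)
  have "Gamma (real n + 3 - real k) = (real n + 3 - real (Suc k)) * Gamma (real n + 3 - real (Suc k))"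
  proof -
    have eq: "real n + 3 - real k = real n + 3 - real (Suc k) + 1" by simp
    have "real n + 3 - real (Suc k) > 0" using Suc.prems by linarith
    then have "real n + 3 - real (Suc k) \<notin> \<int>\<^sub>\<le>\<^sub>0" using nonpos_Ints_nonpos by fastforce
    then show ?thesis unfolding eq by (rule Gamma_plus1)
  qed
  then show ?case using Suc by simp
qed simp

lemma powr_mult_Gamma_eq_fscale:
  assumes "k \<le> n"
  shows "(2 / 3) powr (real n + 3 - real k) * Gamma (real n + 3 - real k) = 2 / 3 * fscale (2 / 3) k (n + 1)"
proof -
  have 1: "real n + 3 - real k = real (n + 3 - k)" "n + 3 - k = Suc (n + 2 - k)" using assms by auto
  show ?thesis
    unfolding 1(1) powr_realpow[of "2 / 3", simplified] unfolding 1(2) of_nat_Suc Gamma_fact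
    by (simp add: fscale_def gfac_def)
qed

theorem mainTheorem9:
  shows "\<exists>c :: nat \<Rightarrow> real.
    c 0 = 36 \<and> c 1 = - 243 / 2 \<and> c 2 = 729 / 32 \<and> c 3 = - 51057 / 256 \<and>
    (\<forall>f \<in> {1 - phi4_z,
           1 - phi4_z + 3 * Abs_fps (\<lambda>n. if n \<ge> 2 then (- 1) ^ n * (1 / 2) ^ n else 0)}.
     \<forall>R :: nat.
      (\<lambda>n. fps_nth f n - exp (- 15 / 4) / (sqrt 2 * pi) *
             (\<Sum>k<R. c k * (2 / 3) powr (real n + 3 - real k) * Gamma (real n + 3 - real k)))
        \<in> O(\<lambda>n. (2 / 3) ^ n * Gamma (real n + 3 - real R)) \<and>
      (\<lambda>n. fps_nth f n - exp (- 15 / 4) / (sqrt 2 * pi) * (2 / 3) ^ (n + 3) * Gamma (real n + 3) *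
             (\<Sum>k<R. (3 / 2) ^ k * c k / (\<Prod>i=1..k. real n + 3 - real i)))
        \<in> O(\<lambda>n. (2 / 3) ^ (n + 3) * Gamma (real n + 3) / (\<Prod>i=1..R. real n + 3 - real i)))"
proof -
  obtain d where d: "\<And>R. has_expansion (2 / 3) (\<lambda>n. phi4_s $ n) d R"
    and d0: "d 0 = - (12 * sqrt 2 / pi * exp (- 15 / 4))"
    using phi4_s_expansion by blast
  define P where "P = exp (- 15 / 4) / (sqrt 2 * pi)"
  \<comment> \<open>Since \<open>d 0\<close> is -24 P and the power of 2/3 in the statement is one
    higher than in the scale, this normalization makes P c_k (2/3) equal to - d_k.\<close>
  define c where "c = (\<lambda>k. 36 * d k / d 0)"
  have d0_nz: "d 0 \<noteq> 0" by (simp add: d0)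
  have "sqrt 2 * sqrt 2 = (2 :: real)" by simp
  then have d0_P: "d 0 = - 24 * P" unfolding d0 P_def by (simp add: field_simps)
  have Pc: "P * c k * (2 / 3) = - d k" for k
    using d0_nz unfolding c_def d0_P by simp
  have c: "c 0 = 36" "c 1 = - 243 / 2" "c 2 = 729 / 32" "c 3 = - 51057 / 256"
    unfolding c_def phi4_s_expansion_coeffs[OF d] using d0_nz by simp_all
  let ?t = "\<lambda>n k. (2 / 3) powr (real n + 3 - real k) * Gamma (real n + 3 - real k)"
  let ?p = "\<lambda>n k. \<Prod>i=1..k. real n + 3 - real i"
  \<comment> \<open>Removing k factors from Gamma (n+3) and k powers of 2/3 shows that the two forms
    of the expansion agree term by term.\<close>
  have descend: "(2 / 3) ^ (n + 3) * Gamma (real n + 3) / ?p n k = (2 / 3) ^ k * ?t n k" if "k \<le> n" for n k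
  proof -
    define p where "p = ?p n k"
    have "p > 0" unfolding p_def using that by (intro prod_pos) auto
    moreover have "(2 / 3 :: real) ^ (n + 3) = (2 / 3) ^ k * (2 / 3) powr (real n + 3 - real k)"
    proof -
      have "(2 / 3 :: real) ^ (n + 3) = (2 / 3) ^ k * (2 / 3) ^ (n + 3 - k)"
        using that by (simp flip: power_add)
      also have "(2 / 3 :: real) ^ (n + 3 - k) = (2 / 3) powr (real (n + 3 - k))"
        by (rule powr_realpow[symmetric]) simp
      also have "real (n + 3 - k) = real n + 3 - real k" using that by simp
      finally show ?thesis .
    qed
    ultimately show ?thesis unfolding Gamma_descending[OF that] p_def[symmetric] by simp
  qed
  have z: "phi4_z $ n = phi4_s $ (n + 1)" for n by (simp add: phi4_s_def)
  \<comment> \<open>Geometric terms lie below every order of the factorial scale; this disposes of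
    the added series in the second case.\<close>
  have small: "(\<lambda>n. (1 / 2) ^ n) \<in> O(\<lambda>n. fscale (2 / 3) R (n + 1))" for R
  proof (rule bigoI[of _ "(3 / 2) ^ 2"])
    show "\<forall>\<^sub>F n in sequentially. norm ((1 / 2) ^ n :: real) \<le> (3 / 2) ^ 2 * norm (fscale (2 / 3) R (n + 1))"
    proof (rule always_eventually, rule allI)
      fix n
      have "(1 / 2 :: real) ^ n \<le> (2 / 3) ^ n" by (rule power_mono) auto
      also have "(2 / 3 :: real) ^ n = (3 / 2) ^ 2 * (2 / 3) ^ (n + 2)" by (simp add: power_add power_divide)
      also have "(2 / 3 :: real) ^ (n + 2) \<le> (2 / 3) ^ (n + 2 - R) * 1"
        unfolding mult_1_right by (rule power_decreasing) auto
      also have "\<dots> \<le> (2 / 3) ^ (n + 2 - R) * fact (n + 2 - R)" by (intro mult_left_mono) auto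
      finally show "norm ((1 / 2) ^ n :: real) \<le> (3 / 2) ^ 2 * norm (fscale (2 / 3) R (n + 1))"
        by (simp add: fscale_def gfac_def)
    qed
  qed
  have main: "(\<lambda>n. f $ n - P * (\<Sum>k<R. c k * ?t n k)) \<in> O(\<lambda>n. fscale (2 / 3) R (n + 1))"
    if f: "f \<in> {1 - phi4_z,
           1 - phi4_z + 3 * Abs_fps (\<lambda>n. if n \<ge> 2 then (- 1) ^ n * (1 / 2) ^ n else 0)}" for f R
  proof -
    \<comment> \<open>For n >= 2 this is 0 in the first case and 3 (-1/2)^n in the second; in both,
      f_n is - s_(n+1) up to a geometric term.\<close>
    define g where "g = (\<lambda>n. f $ n + phi4_s $ (n + 1))"
    have "g \<in> O(\<lambda>n. (1 / 2) ^ n)"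
    proof (rule bigoI[of _ 3])
      show "\<forall>\<^sub>F n in sequentially. norm (g n) \<le> 3 * norm ((1 / 2) ^ n :: real)"
        using eventually_ge_at_top[of 2]
      proof eventually_elim
        case (elim n)
        then show ?case using f by (auto simp: g_def z fps_numeral_fps_const abs_mult power_abs)
      qed
    qed
    then have g: "g \<in> O(\<lambda>n. fscale (2 / 3) R (n + 1))" using small by (rule landau_o.big_trans)
    have "(\<lambda>n. phi4_s $ (n + 1) - (\<Sum>k<R. d k * fscale (2 / 3) k (n + 1))) \<in> O(\<lambda>n. fscale (2 / 3) R (n + 1))"
      using d[of R] unfolding has_expansion_def
      by (rule landau_o.big.compose) (simp add: filterlim_Suc)
    with g have "(\<lambda>n. g n - (phi4_s $ (n + 1) - (\<Sum>k<R. d k * fscale (2 / 3) k (n + 1)))) \<in> O(\<lambda>n. fscale (2 / 3) R (n + 1))"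
      by (rule sum_in_bigo(2))
    moreover have "eventually (\<lambda>n. g n - (phi4_s $ (n + 1) - (\<Sum>k<R. d k * fscale (2 / 3) k (n + 1)))
        = f $ n - P * (\<Sum>k<R. c k * ?t n k)) sequentially"
      using eventually_ge_at_top[of R]
    proof eventually_elim
      case (elim n)
      have "P * (\<Sum>k<R. c k * ?t n k) = (\<Sum>k<R. (P * c k * (2 / 3)) * fscale (2 / 3) k (n + 1))"
        unfolding sum_distrib_left using elim
        by (intro sum.cong) (auto simp: powr_mult_Gamma_eq_fscale)
      also have "\<dots> = - (\<Sum>k<R. d k * fscale (2 / 3) k (n + 1))"
        by (simp only: Pc mult_minus_left sum_negf)
      finally show ?case by (simp add: g_def)
    qed
    ultimately show ?thesis by (rule landau_o.big.in_cong[THEN iffD1, rotated])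
  qed
  have t_bigo: "(\<lambda>n. fscale (2 / 3) R (n + 1)) \<in> O(\<lambda>n. ?t n R)" for R
    by (rule bigoI[of _ "3 / 2"], rule eventually_mono[OF eventually_ge_at_top[of R]])
       (simp add: powr_mult_Gamma_eq_fscale)
  have "(\<lambda>n. f $ n - P * (\<Sum>k<R. c k * (2 / 3) powr (real n + 3 - real k) * Gamma (real n + 3 - real k)))
        \<in> O(\<lambda>n. (2 / 3) ^ n * Gamma (real n + 3 - real R)) \<and>
      (\<lambda>n. f $ n - P * (2 / 3) ^ (n + 3) * Gamma (real n + 3) * (\<Sum>k<R. (3 / 2) ^ k * c k / ?p n k))
        \<in> O(\<lambda>n. (2 / 3) ^ (n + 3) * Gamma (real n + 3) / ?p n R)"
    if f: "f \<in> {1 - phi4_z,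
           1 - phi4_z + 3 * Abs_fps (\<lambda>n. if n \<ge> 2 then (- 1) ^ n * (1 / 2) ^ n else 0)}" for f R
  proof
    have m: "(\<lambda>n. f $ n - P * (\<Sum>k<R. c k * ?t n k)) \<in> O(\<lambda>n. ?t n R)"
      using main[OF f] t_bigo by (rule landau_o.big_trans)
    also have "(\<lambda>n. ?t n R) \<in> O(\<lambda>n. (2 / 3) ^ n * Gamma (real n + 3 - real R))"
    proof (rule bigoI[of _ "(2 / 3) powr (3 - real R)"], rule always_eventually, rule allI)
      fix n
      have "(2 / 3) powr (real n + 3 - real R) = (2 / 3) powr real n * (2 / 3) powr (3 - real R)"
        by (simp flip: powr_add add: algebra_simps)
      then show "norm (?t n R) \<le> (2 / 3) powr (3 - real R) * norm ((2 / 3) ^ n * Gamma (real n + 3 - real R))"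
        by (simp add: powr_realpow abs_mult)
    qed
    finally show "(\<lambda>n. f $ n - P * (\<Sum>k<R. c k * (2 / 3) powr (real n + 3 - real k) * Gamma (real n + 3 - real k)))
        \<in> O(\<lambda>n. (2 / 3) ^ n * Gamma (real n + 3 - real R))"
      by (simp only: mult.assoc)
    have "(\<lambda>n. ?t n R) \<in> O(\<lambda>n. (2 / 3) ^ (n + 3) * Gamma (real n + 3) / ?p n R)"
      by (rule bigoI[of _ "(3 / 2) ^ R"], rule eventually_mono[OF eventually_ge_at_top[of R]])
         (simp only: descend norm_mult norm_power, simp flip: power_mult_distrib mult.assoc)
    with m have "(\<lambda>n. f $ n - P * (\<Sum>k<R. c k * ?t n k)) \<in> O(\<lambda>n. (2 / 3) ^ (n + 3) * Gamma (real n + 3) / ?p n R)"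
      by (rule landau_o.big_trans)
    moreover have "eventually (\<lambda>n. f $ n - P * (\<Sum>k<R. c k * ?t n k)
        = f $ n - P * (2 / 3) ^ (n + 3) * Gamma (real n + 3) * (\<Sum>k<R. (3 / 2) ^ k * c k / ?p n k)) sequentially"
      using eventually_ge_at_top[of R]
    proof eventually_elim
      case (elim n)
      have "c k * ?t n k = (2 / 3) ^ (n + 3) * Gamma (real n + 3) * ((3 / 2) ^ k * c k / ?p n k)" if "k < R" for k
      proof -
        have "(2 / 3) ^ (n + 3) * Gamma (real n + 3) * ((3 / 2) ^ k * c k / ?p n k)
            = (3 / 2) ^ k * c k * ((2 / 3) ^ (n + 3) * Gamma (real n + 3) / ?p n k)" by simp
        also have "\<dots> = (3 / 2) ^ k * c k * ((2 / 3) ^ k * ?t n k)" using that elim by (simp only: descend)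
        also have "\<dots> = ((3 / 2) ^ k * (2 / 3) ^ k) * (c k * ?t n k)" by (simp only: mult_ac)
        also have "(3 / 2 :: real) ^ k * (2 / 3) ^ k = 1" by (simp flip: power_mult_distrib)
        finally show ?thesis by simp
      qed
      then show ?case by (simp add: sum_distrib_left mult.assoc)
    qed
    ultimately show "(\<lambda>n. f $ n - P * (2 / 3) ^ (n + 3) * Gamma (real n + 3) * (\<Sum>k<R. (3 / 2) ^ k * c k / ?p n k))
        \<in> O(\<lambda>n. (2 / 3) ^ (n + 3) * Gamma (real n + 3) / ?p n R)"
      by (rule landau_o.big.in_cong[THEN iffD1, rotated])
  qed
  then show ?thesis using c unfolding P_def by blast
qed

end
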